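(* Let $G$ be a finite abelian group of order $v$ and let $\{D_1,\dots,D_m\}$ be a $(v,m,k,\lambda)$-SEDF in $G$ with $m\geq 3$. Let $p>2$ be a prime divisor of $v$ and suppose $p\nmid\lambda$. Let $\chi$ be a nonprincipal character of $G$ of order $p^a$. Let $q$ be a prime divisor of $\lambda$ with $q^b\mid\lambda$ and $q$ self-conjugate modulo $p^a$. Suppose $\lambda$ is a nonsquare integer and (when $\sum_{i=1}^m\chi(D_i)\neq0$, so that $a_\chi,b_\chi$ are defined) $\frac{4\lambda}{b_\chi^2-a_\chi^2}$ is a nonsquare integer. Then: if $\sum_{i=1}^m\chi(D_i)=0$, then $p\leq\Big(\frac{\lambda}{q^{2\lfloor (b+1)/2\rfloor}}\Big)^2+\frac{\lambda}{q^{2\lfloor (b+1)/2\rfloor}}+1$; if $\gcd(a_\chi+b_\chi,2a_\chi)=1$ and $\sum_{i=1}^m\chi(D_i)\neq0$, then $p\leq\Big(\frac{\lambda}{b_\chi^2-a_\chi^2}\Big)^2+\frac{\lambda}{b_\chi^2-a_\chi^2}+1$; if $\gcd(a_\chi+b_\chi,2a_\chi)=2$ and $\sum_{i=1}^m\chi(D_i)\neq0$, then $p\leq\Big(\frac{4\lambda}{b_\chi^2-a_\chi^2}\Big)^2+\frac{4\lambda}{b_\chi^2-a_\chi^2}+1$.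
   Context: Let $G$ be a finite abelian group of order $v$ with identity $e$. A $(v,m,k,\lambda)$-SEDF in $G$ is a collection $\{D_1,\dots,D_m\}$ of pairwise disjoint $k$-subsets of $G$ such that for each $j$ the multiset $\{xy^{-1}: x\in D_\ell,\ y\in D_j,\ \ell\neq j\}$ contains every non-identity element of $G$ exactly $\lambda$ times and does not contain $e$. Characters are extended linearly to $\mathbb{Z}[G]$. For such an SEDF with $m\geq3$, $D=\bigcup_i D_i$, and a nonprincipal character $\chi$ with $\chi(D)\neq0$, the number $\sqrt{1+4\lambda/|\chi(D)|^2}$ is rational; $a_\chi,b_\chi$ denote the positive integers with $\gcd(a_\chi,b_\chi)=1$ and $b_\chi/a_\chi=\sqrt{1+4\lambda/|\chi(D)|^2}$. Self-conjugacy: for a prime $q$ and positive integer $w$, write $w=q^s u$ with $\gcd(u,q)=1$; $q$ is self-conjugate modulo $w$ if $q^r\equiv-1\pmod u$ for some integer $r$. *)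

theory Defs
  imports Complex_Main "HOL-Library.Multiset" "HOL-Library.Disjoint_Sets"
    "HOL-Algebra.Coset" "HOL-Number_Theory.Cong"
begin

text \<open>The blocks are indexed by \<open>{1..m}\<close>. For fixed \<open>j\<close>, the multiset below has one
  entry for every triple \<open>(l, x, y)\<close> with \<open>l \<noteq> j\<close>, \<open>x \<in> D l\<close> and \<open>y \<in> D j\<close>.\<close>

definition sedf_differences ::
    "('a, 'b) monoid_scheme \<Rightarrow> nat \<Rightarrow> (nat \<Rightarrow> 'a set) \<Rightarrow> nat \<Rightarrow> 'a multiset" where
  "sedf_differences G m D j =
     image_mset (\<lambda>(l, x, y). x \<otimes>\<^bsub>G\<^esub> inv\<^bsub>G\<^esub> y)
       (mset_set (SIGMA l:{1..m} - {j}. D l \<times> D j))"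

definition is_SEDF ::
    "('a, 'b) monoid_scheme \<Rightarrow> nat \<Rightarrow> nat \<Rightarrow> nat \<Rightarrow> nat \<Rightarrow> (nat \<Rightarrow> 'a set) \<Rightarrow> bool" where
  "is_SEDF G v m k lam D \<longleftrightarrow>
     order G = v \<and>
     (\<forall>i\<in>{1..m}. D i \<subseteq> carrier G \<and> card (D i) = k) \<and>
     disjoint_family_on D {1..m} \<and>
     (\<forall>j\<in>{1..m}.
        (\<forall>g\<in>carrier G - {\<one>\<^bsub>G\<^esub>}. count (sedf_differences G m D j) g = lam) \<and>
        \<one>\<^bsub>G\<^esub> \<notin># sedf_differences G m D j)"

definition complex_mult_group :: "complex monoid" where
  "complex_mult_group = \<lparr>carrier = UNIV - {0}, monoid.mult = (*), one = 1\<rparr>"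

definition is_character :: "('a, 'b) monoid_scheme \<Rightarrow> ('a \<Rightarrow> complex) \<Rightarrow> bool" where
  "is_character G \<chi> \<longleftrightarrow> \<chi> \<in> hom G complex_mult_group"

definition nonprincipal :: "('a, 'b) monoid_scheme \<Rightarrow> ('a \<Rightarrow> complex) \<Rightarrow> bool" where
  "nonprincipal G \<chi> \<longleftrightarrow> (\<exists>x\<in>carrier G. \<chi> x \<noteq> 1)"

definition character_order :: "('a, 'b) monoid_scheme \<Rightarrow> ('a \<Rightarrow> complex) \<Rightarrow> nat" where
  "character_order G \<chi> = (LEAST n. n > 0 \<and> (\<forall>x\<in>carrier G. \<chi> x ^ n = 1))"

text \<open>The value of the linear extension of \<open>\<chi>\<close> at the group ring element
  \<open>\<Sum>x\<in>S. x\<close>.\<close>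

definition char_sum :: "('a \<Rightarrow> complex) \<Rightarrow> 'a set \<Rightarrow> complex" where
  "char_sum \<chi> S = (\<Sum>x\<in>S. \<chi> x)"

definition sedf_alpha :: "('a \<Rightarrow> complex) \<Rightarrow> nat \<Rightarrow> 'a set \<Rightarrow> real" where
  "sedf_alpha \<chi> lam S = sqrt (1 + 4 * real lam / (cmod (char_sum \<chi> S))\<^sup>2)"

text \<open>The reduced denominator and numerator of \<open>sedf_alpha \<chi> lam S\<close>, where \<open>S\<close> is
  the union of the blocks. They are meaningful only if that number is rational,
  as is the case for an SEDF with \<open>m \<ge> 3\<close> and \<open>char_sum \<chi> S \<noteq> 0\<close>.\<close>

definition sedf_a :: "('a \<Rightarrow> complex) \<Rightarrow> nat \<Rightarrow> 'a set \<Rightarrow> nat" where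
  "sedf_a \<chi> lam S = (THE a. \<exists>b. a > 0 \<and> b > 0 \<and> gcd a b = 1 \<and>
     real b / real a = sedf_alpha \<chi> lam S)"

definition sedf_b :: "('a \<Rightarrow> complex) \<Rightarrow> nat \<Rightarrow> 'a set \<Rightarrow> nat" where
  "sedf_b \<chi> lam S = (THE b. \<exists>a. a > 0 \<and> b > 0 \<and> gcd a b = 1 \<and>
     real b / real a = sedf_alpha \<chi> lam S)"

lemma reduced_fraction_unique:
  fixes a b c d :: nat
  assumes "a > 0" "c > 0" "gcd a b = 1" "gcd c d = 1"
    and "real b / real a = real d / real c"
  shows "a = c \<and> b = d"
proof -
  have "real (b * c) = real (d * a)"
    using assms(1,2,5) by (simp add: field_simps)
  then have eq: "b * c = d * a"
    by (simp only: of_nat_eq_iff)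
  have "a dvd b * c" "c dvd d * a"
    using eq by (metis dvd_triv_right, metis dvd_triv_right)
  then have "a dvd c" "c dvd a"
    using assms(3,4) by (metis coprime_iff_gcd_eq_1 coprime_dvd_mult_right_iff,
        metis coprime_iff_gcd_eq_1 coprime_dvd_mult_right_iff)
  then have "a = c"
    by (rule dvd_antisym)
  with eq assms(1) show ?thesis
    by simp
qed

lemma sedf_a_b_eqI:
  assumes "a > 0" "b > 0" "gcd a b = 1" "real b / real a = sedf_alpha \<chi> lam S"
  shows "sedf_a \<chi> lam S = a" "sedf_b \<chi> lam S = b"
  unfolding sedf_a_def sedf_b_def
  using assms by (auto intro!: the_equality dest: reduced_fraction_unique)

text \<open>A possibly negative exponent \<open>r\<close> would give the same notion, since \<open>q\<close> is a
  unit of finite order modulo \<open>u\<close>.\<close>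

definition self_conjugate_mod :: "nat \<Rightarrow> nat \<Rightarrow> bool" where
  "self_conjugate_mod q w \<longleftrightarrow>
     (\<exists>s u. w = q ^ s * u \<and> gcd u q = 1 \<and> (\<exists>r::nat. [int q ^ r = - 1] (mod int u)))"

definition nonsquare_integer :: "real \<Rightarrow> bool" where
  "nonsquare_integer x \<longleftrightarrow> x \<in> \<int> \<and> (\<nexists>z::int. x = (of_int z)\<^sup>2)"

end

(* Write N = p^a for the order of the character chi, let z be a primitive N-th root of unity and
   put x_j = chi(D_j), A = chi(D). The defining property of the SEDF gives
   (A - x_j) * cnj(x_j) = -lam.

   If A = 0, then |x_j|^2 = lam. By Frobenius, x^Q is congruent to cnj(x) modulo q for a power Q of q
   that is -1 modulo N, and Z[z] has no nilpotents modulo q; so q divides x_j as soon as it divides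
   |x_j|^2, and descent makes q^((b+1) div 2) a divisor of x_j. If A is nonzero, then
   x_j = A * (a + b)/(2a) or A * (a - b)/(2a), where b/a = sqrt(1 + 4*lam/|A|^2), so that 2a
   respectively a divides A. In each case the quotient is an element of Z[z] whose squared modulus is
   a nonsquare integer n, and it remains to show p <= n^2 + n + 1 for such an element: the relations
   between the powers of z being known, this is an estimate for the autocorrelation of its
   coefficients. *)

theory Submission
  imports "Jordan_Normal_Form.Char_Poly" "HOL-Algebra.Multiplicative_Group" Defs
begin

text \<open>Some condition on n is unavoidable: if n = s^2, then x = s has squared modulus n for
  every p. The value n^2 + n + 1 is attained, for instance by z + z^2 + z^4 with N = 7 and n = 2.
  The obstacle is that the N powers of z are dependent, so that the squared modulus determines the
  autocorrelation of the coefficients only up to functions that are constant on the cosets of the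
  subgroup of order p in Z/N. That there is no further ambiguity amounts to the irreducibility of
  the cyclotomic polynomial, which is drawn from the ramification of p at z - 1. Summation over the
  cosets turns the unknown constant at 0 into a term p * mu. The same dependence leaves a freedom in
  the choice of coefficients, and this is spent on making all coset sums at most p/2 in absolute
  value. The only fact about algebraic integers that is needed is that rational elements of Z[z] are
  integers.\<close>

hide_const (open) Polynomial.order up_ring.monom up_ring.coeff

section \<open>Frobenius congruences modulo a prime\<close>

lemma of_nat_prime_dvd_freshman:
  fixes x y :: "'a::comm_ring_1"
  assumes "prime q"
  shows "of_nat q dvd (x + y) ^ q - (x ^ q + y ^ q)"
proof -
  have q0: "q > 0" using assms prime_gt_0_nat by blast
  have "{..q} = insert 0 (insert q {0<..<q})" using q0 by auto
  then have "(x + y) ^ q =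
      x ^ q + y ^ q + (\<Sum>k\<in>{0<..<q}. of_nat (q choose k) * x ^ k * y ^ (q - k))"
    unfolding binomial_ring using q0 by simp
  moreover have "of_nat q dvd (\<Sum>k\<in>{0<..<q}. of_nat (q choose k) * x ^ k * y ^ (q - k))"
  proof (rule dvd_sum)
    fix k assume "k \<in> {0<..<q}"
    then have "q dvd q choose k" using assms q0 by (intro dvd_choose_prime) auto
    then have "(of_nat q :: 'a) dvd of_nat (q choose k)" by auto
    then show "of_nat q dvd of_nat (q choose k) * x ^ k * y ^ (q - k)"
      by (simp add: mult.assoc)
  qed
  ultimately show ?thesis by simp
qed

lemma int_prime_dvd_power_diff:
  fixes c :: int
  assumes "prime q"
  shows "int q dvd c ^ q - c"
proof -
  have q0: "q > 0" using assms prime_gt_0_nat by blast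
  have nn: "int q dvd int n ^ q - int n" for n
  proof (induction n)
    case 0
    then show ?case using q0 by (simp add: zero_power)
  next
    case (Suc n)
    have "int q dvd (int n + 1) ^ q - (int n ^ q + 1 ^ q)"
      using of_nat_prime_dvd_freshman[OF assms, of "int n" 1] by simp
    from dvd_add[OF this Suc] show ?case by (simp add: algebra_simps)
  qed
  show ?thesis
  proof (cases "c \<ge> 0")
    case True
    then show ?thesis using nn[of "nat c"] by simp
  next
    case False
    \<comment> \<open>The congruence for \<open>(- c) + c = 0\<close> relates
      \<open>(- c) ^ q\<close> to \<open>c ^ q\<close> without a case split on the parity of
      \<open>q\<close>.\<close>
    have "int q dvd 0 - ((- c) ^ q + c ^ q)"
      using of_nat_prime_dvd_freshman[OF assms, of "- c" c] q0 by (simp add: zero_power)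
    moreover have "int q dvd (- c) ^ q - (- c)" using nn[of "nat (- c)"] False by simp
    ultimately have "int q dvd (0 - ((- c) ^ q + c ^ q)) + ((- c) ^ q - (- c))" by (rule dvd_add)
    then have "int q dvd - (c ^ q - c)" by (simp add: algebra_simps)
    then show ?thesis by (simp only: dvd_minus_iff)
  qed
qed

lemma int_poly_dvd_power_diff_pcompose_1:
  fixes f :: "int poly"
  assumes "prime q"
  shows "of_nat q dvd f ^ q - f \<circ>\<^sub>p monom 1 q"
proof (induction f)
  case 0
  then show ?case using assms prime_gt_0_nat[of q] by (simp add: zero_power)
next
  case (pCons c f)
  let ?x = "monom 1 1 :: int poly"
  have eq: "pCons c f = [:c:] + ?x * f" by (simp add: monom_altdef)
  have "of_nat q dvd ([:c:] + ?x * f) ^ q - ([:c:] ^ q + (?x * f) ^ q)"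
    by (rule of_nat_prime_dvd_freshman[OF assms])
  moreover have "(of_nat q :: int poly) dvd [:c:] ^ q - [:c:]"
  proof -
    have "[:int q:] dvd [:c ^ q - c:]" using int_prime_dvd_power_diff[OF assms, of c] by simp
    moreover have "[:c:] ^ q = [:c ^ q:]" by (simp add: poly_const_pow)
    ultimately show ?thesis by (simp add: of_nat_poly)
  qed
  moreover have "of_nat q dvd monom 1 q * (f ^ q - f \<circ>\<^sub>p monom 1 q)"
    using pCons.IH by (rule dvd_mult)
  ultimately have "of_nat q dvd ([:c:] + ?x * f) ^ q - ([:c:] ^ q + (?x * f) ^ q)
      + ([:c:] ^ q - [:c:]) + monom 1 q * (f ^ q - f \<circ>\<^sub>p monom 1 q)"
    by (intro dvd_add)
  moreover have cancel: "P - (K' + u * v) + (K' - K) + u * (v - w) = P - (K + u * w)"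
    for P K K' u v w :: "int poly"
    by (simp add: algebra_simps)
  moreover have "?x ^ q = monom 1 q" by (simp add: monom_power)
  ultimately show ?case
    unfolding eq[symmetric] pcompose_pCons power_mult_distrib by (simp only: cancel)
qed

text \<open>Kept in Z[X] because it serves twice: evaluated at \<open>z\<close> it is the Frobenius
  congruence of Z[z] modulo \<open>q\<close>, and for X - 1 with \<open>q = p\<close> it yields the
  Eisenstein shape of the cyclotomic polynomial.\<close>

lemma int_poly_dvd_power_diff_pcompose:
  fixes f :: "int poly"
  assumes "prime q"
  shows "of_nat q dvd f ^ (q ^ r) - f \<circ>\<^sub>p monom 1 (q ^ r)"
proof (induction r)
  case 0
  then show ?case by (simp add: pcompose_idR monom_altdef)
next
  case (Suc r)
  let ?F = "f ^ (q ^ r)" and ?G = "f \<circ>\<^sub>p monom 1 (q ^ r)"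
  from Suc have "of_nat q dvd ?F ^ q - ?G ^ q"
    by (metis dvd_trans power_diff_sumr2 dvd_triv_left)
  moreover have "of_nat q dvd ?G ^ q - ?G \<circ>\<^sub>p monom 1 q"
    by (rule int_poly_dvd_power_diff_pcompose_1[OF assms])
  ultimately have "of_nat q dvd (?F ^ q - ?G ^ q) + (?G ^ q - ?G \<circ>\<^sub>p monom 1 q)"
    by (rule dvd_add)
  moreover have "?G \<circ>\<^sub>p monom 1 q = f \<circ>\<^sub>p monom 1 (q ^ Suc r)"
  proof -
    have "monom (1::int) (q ^ r) \<circ>\<^sub>p monom 1 q = monom 1 (q ^ Suc r)"
      by (simp add: monom_altdef pcompose_hom.hom_power pcompose_pCons power_mult)
    then show ?thesis by (simp only: pcompose_assoc[symmetric])
  qed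
  moreover have "?F ^ q = f ^ (q ^ Suc r)"
    by (simp add: power_mult[symmetric] mult.commute)
  ultimately show ?case by simp
qed

section \<open>The ring Z[z] as a set of complex numbers\<close>

definition int_adjoin :: "complex \<Rightarrow> complex set" where
  "int_adjoin z = range (\<lambda>f. poly (of_int_poly f) z)"

lemma int_adjoinI: "poly (of_int_poly f) z \<in> int_adjoin z"
  by (simp add: int_adjoin_def)

lemma int_adjoin_of_int [simp]: "of_int c \<in> int_adjoin z"
  using int_adjoinI[of "[:c:]" z] by (simp add: hom_distribs)

lemma int_adjoin_of_nat [simp]: "of_nat c \<in> int_adjoin z"
  using int_adjoin_of_int[of "int c" z] by simp

lemma int_adjoin_0_1 [simp]: "0 \<in> int_adjoin z" "1 \<in> int_adjoin z"
  using int_adjoin_of_int[of 0 z] int_adjoin_of_int[of 1 z] by simp_all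

lemma int_adjoin_self [simp]: "z \<in> int_adjoin z"
  using int_adjoinI[of "[:0, 1:]" z] by simp

lemma int_adjoin_add [intro]: "x \<in> int_adjoin z \<Longrightarrow> y \<in> int_adjoin z \<Longrightarrow> x + y \<in> int_adjoin z"
  unfolding int_adjoin_def by (auto simp: of_int_poly_hom.hom_add[symmetric] poly_add[symmetric]
      simp del: poly_add of_int_poly_hom.hom_add)

lemma int_adjoin_mult [intro]: "x \<in> int_adjoin z \<Longrightarrow> y \<in> int_adjoin z \<Longrightarrow> x * y \<in> int_adjoin z"
  unfolding int_adjoin_def by (auto simp: of_int_poly_hom.hom_mult[symmetric] poly_mult[symmetric]
      simp del: poly_mult of_int_poly_hom.hom_mult)

lemma int_adjoin_uminus [intro]: "x \<in> int_adjoin z \<Longrightarrow> - x \<in> int_adjoin z"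
  using int_adjoin_mult[OF int_adjoin_of_int[of "- 1" z]] by simp

lemma int_adjoin_diff [intro]: "x \<in> int_adjoin z \<Longrightarrow> y \<in> int_adjoin z \<Longrightarrow> x - y \<in> int_adjoin z"
  using int_adjoin_add[OF _ int_adjoin_uminus] by fastforce

lemma int_adjoin_power [intro]: "x \<in> int_adjoin z \<Longrightarrow> x ^ n \<in> int_adjoin z"
  by (induction n) auto

lemma int_adjoin_sum [intro]:
  "(\<And>i. i \<in> A \<Longrightarrow> f i \<in> int_adjoin z) \<Longrightarrow> sum f A \<in> int_adjoin z"
  by (induction A rule: infinite_finite_induct) auto

lemma cnj_mult_root_of_unity:
  fixes z :: complex
  assumes "z ^ N = 1" "N > 0"
  shows "cnj z * z = 1"
proof -
  have "cmod z = 1" using power_eq_1_iff[of z N] assms by auto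
  then show ?thesis by (metis complex_norm_square mult.commute of_real_1 power_one)
qed

lemma cnj_poly_of_int: "cnj (poly (of_int_poly f) z) = poly (of_int_poly f) (cnj z)"
  by (induction f) (simp_all add: hom_distribs)

lemma int_adjoin_cnj:
  assumes "z ^ N = 1" "N > 0" "x \<in> int_adjoin z"
  shows "cnj x \<in> int_adjoin z"
proof -
  have "cnj z * z = 1" using assms(1,2)
    by (rule cnj_mult_root_of_unity)
  moreover have "z ^ (N - 1) * z = 1" using assms(1,2) by (metis Suc_diff_1 power_Suc2)
  ultimately have c: "cnj z = z ^ (N - 1)"
    by (metis mult.assoc mult.right_neutral mult.commute)
  obtain f where "x = poly (of_int_poly f) z" using assms(3) by (auto simp: int_adjoin_def)
  then have "cnj x = poly (of_int_poly f) (z ^ (N - 1))"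
    by (simp add: cnj_poly_of_int c)
  also have "\<dots> = poly (of_int_poly (f \<circ>\<^sub>p monom 1 (N - 1))) z"
    by (simp add: of_int_hom.map_poly_pcompose poly_pcompose poly_monom)
  finally show ?thesis by (simp add: int_adjoinI)
qed

text \<open>All \<open>N\<close> powers are used instead of a basis. The coefficients are then not
  unique, but their index set is the cyclic group Z/N, on which the autocorrelation lives.\<close>

lemma int_adjoin_as_sum:
  assumes "z ^ N = 1" "N > 0" "x \<in> int_adjoin z"
  obtains c :: "nat \<Rightarrow> int" where "x = (\<Sum>i<N. of_int (c i) * z ^ i)"
proof -
  obtain f where f: "x = poly (of_int_poly f) z" using assms(3) by (auto simp: int_adjoin_def)
  define c where "c = (\<lambda>r. \<Sum>i\<in>{i\<in>{..degree f}. i mod N = r}. coeff f i)"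
  have zm: "z ^ i = z ^ (i mod N)" for i
    using assms(1) by (metis div_mult_mod_eq mult.commute mult.right_neutral power_add power_mult power_one mult_1)
  have "x = (\<Sum>i\<le>degree f. of_int (coeff f i) * z ^ i)"
    unfolding f by (simp add: poly_altdef)
  also have "\<dots> = (\<Sum>r<N. \<Sum>i\<in>{i\<in>{..degree f}. i mod N = r}. of_int (coeff f i) * z ^ i)"
    using assms(2) by (intro sum.group[symmetric]) auto
  also have "\<dots> = (\<Sum>r<N. of_int (c r) * z ^ r)"
    unfolding c_def of_int_sum sum_distrib_right
    by (intro sum.cong refl) (use zm in auto)
  finally show ?thesis using that by blast
qed

text \<open>Multiplication by \<open>x\<close> sends each \<open>z ^ j\<close> to an integer
  combination of powers of \<open>z\<close>. So the vector of these powers is an eigenvector, with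
  eigenvalue \<open>x\<close>, of an integer matrix, whose characteristic polynomial is monic and
  integral.\<close>

lemma algebraic_int_int_adjoin:
  assumes "z ^ N = 1" "N > 0" "x \<in> int_adjoin z"
  shows "algebraic_int x"
proof -
  have "\<exists>c. x * z ^ j = (\<Sum>i<N. of_int (c i) * z ^ i)" for j
    using int_adjoin_as_sum[OF assms(1,2)] assms(3) int_adjoin_mult int_adjoin_power int_adjoin_self
    by metis
  then obtain c :: "nat \<Rightarrow> nat \<Rightarrow> int" where c: "x * z ^ j = (\<Sum>i<N. of_int (c j i) * z ^ i)" for j
    by metis
  define A where "A = mat N N (\<lambda>(j, i). c j i)"
  define v where "v = vec N (\<lambda>i. z ^ i)"
  have A: "A \<in> carrier_mat N N" by (simp add: A_def)
  let ?A = "map_mat of_int A :: complex mat"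
  have "?A *\<^sub>v v = x \<cdot>\<^sub>v v"
    by (rule eq_vecI) (auto simp: A_def v_def scalar_prod_def c atLeast0LessThan)
  moreover have "v \<noteq> 0\<^sub>v N"
  proof
    assume "v = 0\<^sub>v N"
    then have "v $ 0 = 0" using assms(2) by simp
    then show False using assms(2) by (simp add: v_def)
  qed
  ultimately have "eigenvalue ?A x"
    unfolding eigenvalue_def eigenvector_def using A by (intro exI[of _ v]) (auto simp: v_def)
  then have "poly (char_poly ?A) x = 0"
    using eigenvalue_root_char_poly[of ?A N x] A by simp
  moreover have "char_poly ?A = of_int_poly (char_poly A)"
    by (rule of_int_hom.char_poly_hom[OF A])
  ultimately have "poly (of_int_poly (char_poly A)) x = 0"
    by metis
  moreover have "lead_coeff (char_poly A) = 1" using degree_monic_char_poly[OF A] by simp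
  ultimately show ?thesis unfolding algebraic_int_altdef_ipoly by blast
qed

text \<open>\<open>x ^ (Q * Q)\<close> is congruent to \<open>x\<close> modulo \<open>q\<close>,
  because conjugating twice does nothing. It also contains the factor \<open>x ^ Q * x\<close>,
  which is congruent to \<open>x * cnj x\<close> and hence to 0.\<close>

lemma self_conjugate_dvd:
  assumes z: "z ^ N = 1" and N: "N > 2" and q: "prime q"
    and qr: "[int q ^ r = - 1] (mod int N)"
    and x: "x \<in> int_adjoin z" and y: "y \<in> int_adjoin z" "x * cnj x = of_nat q * y"
  obtains w where "w \<in> int_adjoin z" "x = of_nat q * w"
proof -
  define Q where "Q = q ^ r"
  have "int N dvd int (Q + 1)"
    using qr unfolding Q_def cong_iff_dvd_diff by (simp add: add.commute)
  then have "N dvd Q + 1" by (simp only: int_dvd_int_iff)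
  then obtain k where k: "Q + 1 = N * k" ..
  \<comment> \<open>\<open>N > 2\<close> rules out \<open>Q = 1\<close>, for which
    \<open>Q * Q\<close> would be smaller than \<open>Q + 1\<close>.\<close>
  have Q2: "Q \<ge> 2"
    using dvd_imp_le[OF \<open>N dvd Q + 1\<close>] N by simp
  have zQ: "z ^ Q = cnj z"
  proof -
    have "cnj z * z = 1" using z N
      by (intro cnj_mult_root_of_unity[of z N]) auto
    moreover have "z ^ Q * z = 1" using k z by (metis Suc_eq_plus1 power_Suc2 power_mult power_one)
    ultimately show ?thesis by (metis mult.assoc mult.right_neutral mult.commute)
  qed
  have zQQ: "z ^ (Q * Q) = z" using zQ by (metis complex_cnj_cnj complex_cnj_power power_mult)
  obtain f where f: "x = poly (of_int_poly f) z" using x by (auto simp: int_adjoin_def)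
  have frob: "\<exists>w\<in>int_adjoin z. x ^ (q ^ s) = poly (of_int_poly f) (z ^ (q ^ s)) + of_nat q * w" for s
  proof -
    obtain g where g: "f ^ (q ^ s) - f \<circ>\<^sub>p monom 1 (q ^ s) = of_nat q * g"
      using int_poly_dvd_power_diff_pcompose[OF q, of f s] by blast
    then have "f ^ (q ^ s) = f \<circ>\<^sub>p monom 1 (q ^ s) + of_nat q * g" by (simp add: algebra_simps)
    then have "poly (of_int_poly (f ^ (q ^ s))) z =
        poly (of_int_poly (f \<circ>\<^sub>p monom 1 (q ^ s) + of_nat q * g)) z" by simp
    then have "x ^ (q ^ s) = poly (of_int_poly f) (z ^ (q ^ s)) + of_nat q * poly (of_int_poly g) z"
      by (simp add: f of_int_hom.map_poly_pcompose of_int_poly_hom.hom_power of_int_poly_hom.hom_add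
          of_int_poly_hom.hom_mult poly_pcompose poly_monom of_int_poly_hom.hom_of_nat)
    then show ?thesis using int_adjoinI by blast
  qed
  obtain w1 where w1: "w1 \<in> int_adjoin z" "x ^ Q = cnj x + of_nat q * w1"
    using frob[of r] by (auto simp: Q_def[symmetric] zQ f cnj_poly_of_int)
  obtain w2 where w2: "w2 \<in> int_adjoin z" "x ^ (Q * Q) = x + of_nat q * w2"
    using frob[of "r + r"] by (auto simp: Q_def[symmetric] zQQ power_add f[symmetric])
  have "Q * Q = Q + 1 + (Q * Q - (Q + 1))"
    using Q2 mult_le_mono1[OF Q2, of Q] by linarith
  then have "x ^ (Q * Q) = x ^ Q * x * x ^ (Q * Q - (Q + 1))"
    by (metis power_add power_one_right)
  then have "x = of_nat q * ((y + w1 * x) * x ^ (Q * Q - (Q + 1)) - w2)"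
    using w1(2) w2(2) y(2) by (simp add: algebra_simps)
  moreover have "(y + w1 * x) * x ^ (Q * Q - (Q + 1)) - w2 \<in> int_adjoin z"
    by (intro int_adjoin_diff int_adjoin_mult int_adjoin_add int_adjoin_power w1(1) w2(1) x y(1))
  ultimately show ?thesis using that by metis
qed

section \<open>Cyclotomic polynomials of prime power order and their roots\<close>

definition prime_power_cyclotomic :: "nat \<Rightarrow> nat \<Rightarrow> int poly" where
  "prime_power_cyclotomic p M = (\<Sum>k<p. monom 1 (k * M))"

lemma prime_power_cyclotomic_mult:
  "(monom 1 M - 1) * prime_power_cyclotomic p M = monom 1 (p * M) - 1"
proof -
  have "monom (1::int) M ^ k = monom 1 (k * M)" for k by (simp add: monom_power mult.commute)
  then show ?thesis
    using power_diff_1_eq[of "monom (1::int) M" p] by (simp add: prime_power_cyclotomic_def)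
qed

text \<open>Modulo \<open>p\<close>, both X^M - 1 and X^(pM) - 1 are powers of X - 1, hence so is
  their quotient. The value \<open>p\<close> at 1 gives \<open>poly h 1 = 1\<close>; this is
  Eisenstein's condition that the constant term in powers of X - 1 is not divisible by p^2.\<close>

lemma prime_power_cyclotomic_eisenstein:
  assumes p: "prime p" and M: "M = p ^ n"
  obtains h where "prime_power_cyclotomic p M = [:- 1, 1:] ^ ((p - 1) * M) + of_nat p * h"
    "poly h 1 = 1"
proof -
  let ?P = "prime_power_cyclotomic p M" and ?y = "[:- 1, 1:] :: int poly"
  have p1: "p > 1" using p prime_gt_1_nat by blast
  have yc: "?y \<circ>\<^sub>p monom 1 m = monom 1 m - 1" for m
    by (simp add: pcompose_pCons) (simp add: one_pCons)
  obtain g where g: "?y ^ M - (monom 1 M - 1) = of_nat p * g"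
    using int_poly_dvd_power_diff_pcompose[OF p, of ?y n] unfolding M yc by blast
  obtain g' where g': "?y ^ (p * M) - (monom 1 (p * M) - 1) = of_nat p * g'"
    using int_poly_dvd_power_diff_pcompose[OF p, of ?y "Suc n"] unfolding M yc power_Suc by blast
  have pM: "p * M = M + (p - 1) * M" using p1 by (cases p) auto
  have g2: "?y ^ M = monom 1 M - 1 + of_nat p * g"
    and g'2: "?y ^ (p * M) = monom 1 (p * M) - 1 + of_nat p * g'"
    using g g' by (simp_all add: diff_eq_eq add.commute)
  have "?y ^ M * (?P - ?y ^ ((p - 1) * M)) = ?y ^ M * ?P - ?y ^ (p * M)"
    unfolding pM by (simp only: right_diff_distrib power_add)
  also have "\<dots> = (monom 1 M - 1) * ?P + of_nat p * g * ?P - ?y ^ (p * M)"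
    by (simp only: g2 distrib_right)
  also have "\<dots> = of_nat p * (g * ?P - g')"
    unfolding prime_power_cyclotomic_mult g'2 by (simp add: right_diff_distrib)
  finally have "[:int p:] dvd ?y ^ M * (?P - ?y ^ ((p - 1) * M))"
    by (intro dvdI[of _ _ "g * ?P - g'"]) (simp add: of_nat_poly)
  moreover have pe: "prime_elem [:int p:]"
    using p by (intro lift_prime_elem_poly) auto
  moreover have "\<not> [:int p:] dvd ?y ^ M"
  proof
    assume "[:int p:] dvd ?y ^ M"
    then have "[:int p:] dvd ?y" using pe prime_elem_dvd_power by blast
    then have "int p dvd coeff ?y 1" unfolding const_poly_dvd_iff by blast
    then show False using p1 by simp
  qed
  ultimately have "[:int p:] dvd ?P - ?y ^ ((p - 1) * M)"
    using prime_elem_dvd_multD by blast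
  then obtain h where "?P - ?y ^ ((p - 1) * M) = [:int p:] * h" by (elim dvdE)
  then have h: "?P = ?y ^ ((p - 1) * M) + of_nat p * h"
    by (simp add: of_nat_poly algebra_simps)
  have "M > 0" using p1 by (simp add: M)
  then have "poly (?y ^ ((p - 1) * M)) 1 = 0" using p1 by (simp add: zero_power)
  moreover have "poly ?P 1 = int p"
    by (simp add: prime_power_cyclotomic_def poly_sum poly_monom)
  moreover have "poly ?P 1 = poly (?y ^ ((p - 1) * M)) 1 + int p * poly h 1"
    unfolding h by simp
  ultimately have "int p * poly h 1 = int p" by linarith
  then have "poly h 1 = 1" using p1 by simp
  with h show ?thesis using that by blast
qed

text \<open>The order of \<open>z\<close> divides a power of the prime \<open>p\<close>, so
  \<open>z ^ M \<noteq> 1\<close> forces it to be exactly \<open>N\<close>.\<close>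

locale prime_power_root_of_unity =
  fixes p l N M :: nat and z :: complex
  assumes prime_p: "prime p"
    and M_eq: "M = p ^ l" and N_eq: "N = p * M"
    and root: "z ^ N = 1" and primitive: "z ^ M \<noteq> 1"
begin

text \<open>Euler's totient of \<open>N\<close>, the degree of the cyclotomic polynomial.\<close>

abbreviation "d \<equiv> (p - 1) * M"

lemma p_gt_1: "p > 1"
  using prime_p prime_gt_1_nat by blast

lemma M_pos: "M > 0"
  using p_gt_1 by (simp add: M_eq)

lemma N_pos: "N > 0"
  using p_gt_1 M_pos by (simp add: N_eq)

lemma N_eq_add: "N = d + M"
  using p_gt_1 by (cases p) (auto simp: N_eq)

lemma cyclotomic_root: "poly (of_int_poly (prime_power_cyclotomic p M)) z = 0"
proof -
  have "poly (of_int_poly ((monom 1 M - 1) * prime_power_cyclotomic p M)) z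
      = poly (of_int_poly (monom 1 (p * M) - 1)) z"
    unfolding prime_power_cyclotomic_mult ..
  then have "(z ^ M - 1) * poly (of_int_poly (prime_power_cyclotomic p M)) z = z ^ N - 1"
    by (simp add: hom_distribs poly_monom N_eq)
  then show ?thesis using root primitive by simp
qed

lemma sum_root_powers: "(\<Sum>k<p. z ^ (k * M)) = 0"
  using cyclotomic_root by (simp add: prime_power_cyclotomic_def hom_distribs poly_sum poly_monom)

text \<open>Since \<open>h - 1\<close> vanishes at 1, \<open>h\<close> takes at \<open>z\<close> a
  value congruent to 1 modulo \<open>z - 1\<close>. That congruence replaces the statement that the
  factor is a unit.\<close>

lemma ramification:
  obtains t where "t \<in> int_adjoin z" "(z - 1) ^ d = - of_nat p * (1 + (z - 1) * t)"
proof -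
  obtain h where h: "prime_power_cyclotomic p M = [:- 1, 1:] ^ d + of_nat p * h" "poly h 1 = 1"
    using prime_power_cyclotomic_eisenstein[OF prime_p M_eq] by blast
  have "poly (h - 1) 1 = 0" using h(2) by simp
  then obtain s where s: "h - 1 = [:- 1, 1:] * s"
    unfolding poly_eq_0_iff_dvd by (elim dvdE)
  define t where "t = poly (of_int_poly s) z"
  have "poly (of_int_poly h) z = poly (of_int_poly (1 + [:- 1, 1:] * s)) z"
    unfolding s[symmetric] by simp
  then have hz: "poly (of_int_poly h) z = 1 + (z - 1) * t"
    by (simp add: hom_distribs t_def algebra_simps)
  have "poly (of_int_poly ([:- 1, 1:] ^ d + of_nat p * h)) z = 0"
    using cyclotomic_root unfolding h(1) .
  then have "(z - 1) ^ d + of_nat p * poly (of_int_poly h) z = 0"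
    by (simp add: hom_distribs)
  then have "(z - 1) ^ d = - of_nat p * (1 + (z - 1) * t)"
    unfolding hz by (simp add: eq_neg_iff_add_eq_0)
  then show ?thesis by (rule that[rotated]) (simp add: t_def int_adjoinI)
qed

lemma z_ne_1: "z \<noteq> 1"
  using primitive by auto

text \<open>By \<open>ramification\<close>, if \<open>z - 1\<close> were a unit, then \<open>1/p\<close> would be an algebraic integer.\<close>

lemma inverse_not_in_int_adjoin:
  assumes "w \<in> int_adjoin z"
  shows "(z - 1) * w \<noteq> 1"
proof
  assume w: "(z - 1) * w = 1"
  obtain t where t: "t \<in> int_adjoin z" "(z - 1) ^ d = - of_nat p * (1 + (z - 1) * t)"
    using ramification .
  have "1 = (z - 1) ^ d * w ^ d" by (simp add: w power_mult_distrib[symmetric])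
  then have "1 = of_nat p * (- (1 + (z - 1) * t) * w ^ d)"
    unfolding t(2) by (simp add: algebra_simps)
  then have inv: "inverse (of_nat p) = - (1 + (z - 1) * t) * w ^ d"
    using p_gt_1 by (simp add: inverse_eq_divide divide_eq_eq mult.commute)
  have "- (1 + (z - 1) * t) * w ^ d \<in> int_adjoin z"
    by (intro int_adjoin_mult int_adjoin_uminus int_adjoin_add int_adjoin_diff int_adjoin_power
        t(1) assms) auto
  then have "algebraic_int (inverse (of_nat p) :: complex)"
    unfolding inv by (rule algebraic_int_int_adjoin[OF root N_pos])
  then have "inverse (of_nat p :: complex) \<in> \<int>"
    by (rule rational_algebraic_int_is_int) auto
  then obtain k where "inverse (of_nat p :: complex) = of_int k" by (elim Ints_cases)
  then have "(of_int (k * int p) :: complex) = of_int 1" using p_gt_1 by (simp add: field_simps)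
  then have "k * int p = 1" by (simp only: of_int_eq_iff)
  then have "int p dvd 1" by (metis dvd_triv_right)
  then show False using p_gt_1 by simp
qed

text \<open>In powers of \<open>z - 1\<close>, the lowest term of \<open>f z\<close> whose coefficient is prime to \<open>p\<close> cannot
  be cancelled: by \<open>ramification\<close>, the terms below it are divisible by \<open>(z - 1) ^ d\<close>, up to a
  factor congruent to \<open>1\<close> modulo \<open>z - 1\<close>.\<close>

lemma eq_0_if_root:
  assumes f: "poly (of_int_poly f) z = 0" and deg: "degree f < d"
  shows "f = 0"
proof (rule ccontr)
  assume "f \<noteq> 0"
  \<comment> \<open>After division by the content, not all coefficients are divisible by
    \<open>p\<close>; this persists under the invertible substitution of X + 1 that defines
    \<open>g\<close>.\<close>
  define f' where "f' = primitive_part f"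
  have ff': "f = Polynomial.smult (content f) f'" by (simp add: f'_def)
  have c0: "content f \<noteq> 0" using \<open>f \<noteq> 0\<close> by simp
  have f'0: "poly (of_int_poly f') z = 0"
  proof -
    have "poly (of_int_poly (Polynomial.smult (content f) f')) z = 0" using f ff' by simp
    then show ?thesis using c0 by (simp add: hom_distribs)
  qed
  define g where "g = f' \<circ>\<^sub>p [:1, 1:]"
  let ?\<pi> = "z - 1"
  have deg_g: "degree g < d"
  proof -
    have "degree f' = degree f" by (simp add: f'_def)
    then show ?thesis using deg by (simp add: g_def degree_pcompose)
  qed
  have g\<pi>: "poly (of_int_poly g) ?\<pi> = 0"
    using f'0 by (simp add: g_def of_int_hom.map_poly_pcompose poly_pcompose hom_distribs)
  have "\<exists>i. \<not> int p dvd coeff g i"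
  proof (rule ccontr)
    assume "\<not> ?thesis"
    then have "[:int p:] dvd g" by (simp add: const_poly_dvd_iff)
    then obtain k where k: "g = [:int p:] * k" by (elim dvdE)
    have "f' = g \<circ>\<^sub>p [:- 1, 1:]"
      by (simp add: g_def pcompose_assoc[symmetric] pcompose_pCons pcompose_idR)
    also have "\<dots> = [:int p:] * (k \<circ>\<^sub>p [:- 1, 1:])"
      unfolding k by (simp add: pcompose_smult)
    finally have "[:int p:] dvd f'" by (rule dvdI)
    then have "int p dvd content f'" by (simp add: const_poly_dvd_iff_dvd_content)
    then show False using \<open>f \<noteq> 0\<close> p_gt_1 by (simp add: f'_def)
  qed
  then obtain i0 where i0: "\<not> int p dvd coeff g i0" "\<And>i. i < i0 \<Longrightarrow> int p dvd coeff g i"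
    using exists_least_iff[of "\<lambda>i. \<not> int p dvd coeff g i"] by auto
  have i0d: "i0 < d" using i0(1) deg_g coeff_eq_0[of g i0] by (metis dvd_0_right leI le_less_trans less_le_trans)
  define e where "e = coeff g i0"
  have "0 = (\<Sum>i\<le>degree g. of_int (coeff g i) * ?\<pi> ^ i)"
    using g\<pi> by (simp add: poly_altdef)
  also have "\<dots> = (\<Sum>i<d. of_int (coeff g i) * ?\<pi> ^ i)"
    using deg_g by (intro sum.mono_neutral_left) (auto simp: coeff_eq_0)
  also have "{..<d} = {..<i0} \<union> insert i0 {i0<..<d}" using i0d by auto
  also have "(\<Sum>i\<in>\<dots>. of_int (coeff g i) * ?\<pi> ^ i) =
      (\<Sum>i<i0. of_int (coeff g i) * ?\<pi> ^ i) + (of_int e * ?\<pi> ^ i0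
        + (\<Sum>i\<in>{i0<..<d}. of_int (coeff g i) * ?\<pi> ^ i))"
    by (subst sum.union_disjoint) (auto simp: e_def)
  finally have total: "(\<Sum>i<i0. of_int (coeff g i) * ?\<pi> ^ i) + (of_int e * ?\<pi> ^ i0
        + (\<Sum>i\<in>{i0<..<d}. of_int (coeff g i) * ?\<pi> ^ i)) = 0" by simp
  define A where "A = (\<Sum>i<i0. of_int (coeff g i div int p) * ?\<pi> ^ i)"
  define B where "B = (\<Sum>i\<in>{i0<..<d}. of_int (coeff g i) * ?\<pi> ^ (i - Suc i0))"
  have \<pi>R: "?\<pi> \<in> int_adjoin z" by (intro int_adjoin_diff) auto
  have AB: "A \<in> int_adjoin z" "B \<in> int_adjoin z"
    unfolding A_def B_def by (intro int_adjoin_sum int_adjoin_mult int_adjoin_power \<pi>R int_adjoin_of_int)+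
  have e1: "(\<Sum>i<i0. of_int (coeff g i) * ?\<pi> ^ i) = of_nat p * A"
    unfolding A_def sum_distrib_left
  proof (rule sum.cong[OF refl])
    fix i assume "i \<in> {..<i0}"
    then have "coeff g i = int p * (coeff g i div int p)" using i0(2) by simp
    then have "(of_int (coeff g i) :: complex) = of_nat p * of_int (coeff g i div int p)"
      by (metis of_int_mult of_int_of_nat_eq)
    then show "of_int (coeff g i) * ?\<pi> ^ i = of_nat p * (of_int (coeff g i div int p) * ?\<pi> ^ i)"
      by simp
  qed
  have e2: "(\<Sum>i\<in>{i0<..<d}. of_int (coeff g i) * ?\<pi> ^ i) = ?\<pi> ^ i0 * (?\<pi> * B)"
    unfolding B_def sum_distrib_left
  proof (rule sum.cong[OF refl])
    fix i assume "i \<in> {i0<..<d}"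
    then have "i = i0 + Suc (i - Suc i0)" by auto
    then have "?\<pi> ^ i = ?\<pi> ^ i0 * (?\<pi> * ?\<pi> ^ (i - Suc i0))" by (metis power_add power_Suc)
    then show "of_int (coeff g i) * ?\<pi> ^ i =
        ?\<pi> ^ i0 * (?\<pi> * (of_int (coeff g i) * ?\<pi> ^ (i - Suc i0)))" by simp
  qed
  have tot: "of_nat p * A + ?\<pi> ^ i0 * (of_int e + ?\<pi> * B) = 0"
    using total unfolding e1 e2 by (simp only: distrib_left mult.commute[of "of_int e"])
  obtain t where t: "t \<in> int_adjoin z" "?\<pi> ^ d = - of_nat p * (1 + ?\<pi> * t)"
    using ramification .
  have d_split: "d = i0 + Suc (d - Suc i0)" using i0d by simp
  have \<pi>d: "?\<pi> ^ d = ?\<pi> ^ i0 * (?\<pi> * ?\<pi> ^ (d - Suc i0))"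
    by (subst d_split) (simp only: power_add power_Suc)
  \<comment> \<open>The factor \<open>1 + ?\<pi> * t\<close> converts \<open>of_nat p * A\<close>
    into a multiple of \<open>?\<pi> ^ d\<close>. As \<open>i0 < d\<close>, cancelling
    \<open>?\<pi> ^ i0\<close> leaves \<open>e\<close> divisible by \<open>?\<pi>\<close>.\<close>
  have "0 = (1 + ?\<pi> * t) * (of_nat p * A + ?\<pi> ^ i0 * (of_int e + ?\<pi> * B))"
    unfolding tot by simp
  also have "\<dots> = - (?\<pi> ^ d) * A + (1 + ?\<pi> * t) * (?\<pi> ^ i0 * (of_int e + ?\<pi> * B))"
    unfolding t(2) by (simp add: algebra_simps)
  also have "\<dots> = ?\<pi> ^ i0 * ((1 + ?\<pi> * t) * (of_int e + ?\<pi> * B) - ?\<pi> * ?\<pi> ^ (d - Suc i0) * A)"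
    unfolding \<pi>d by (simp add: algebra_simps)
  finally have "(1 + ?\<pi> * t) * (of_int e + ?\<pi> * B) - ?\<pi> * ?\<pi> ^ (d - Suc i0) * A = 0"
    using z_ne_1 by simp
  then have e\<pi>: "of_int e = ?\<pi> * (?\<pi> ^ (d - Suc i0) * A - (1 + ?\<pi> * t) * B - t * of_int e)"
    by (simp add: algebra_simps)
  have "d > 0" using p_gt_1 M_pos by simp
  then have "?\<pi> ^ d = ?\<pi> * ?\<pi> ^ (d - 1)" by (metis Suc_diff_1 power_Suc)
  then have "?\<pi> * ?\<pi> ^ (d - 1) = - of_nat p * (1 + ?\<pi> * t)"
    using t(2) by metis
  moreover have "P = y * (- u - P * v)" if "y * u = - P * (1 + y * v)" for P y u v :: complex
    by (simp only: right_diff_distrib mult_minus_right that) (simp add: algebra_simps)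
  ultimately have p\<pi>: "of_nat p = ?\<pi> * (- (?\<pi> ^ (d - 1)) - of_nat p * t)"
    by metis
  \<comment> \<open>Both \<open>e\<close> and \<open>p\<close> are multiples of
    \<open>?\<pi>\<close> in Z[z]; being coprime, they would make it a unit.\<close>
  have "coprime (int p) e"
    using i0(1) prime_p by (intro prime_imp_coprime) (auto simp: e_def)
  then obtain r s where "r * int p + s * e = 1"
    using bezout_int[of "int p" e] by (auto simp: coprime_iff_gcd_eq_1)
  then have "of_int r * of_nat p + of_int s * of_int e = (1::complex)"
    by (metis of_int_1 of_int_add of_int_mult of_int_of_nat_eq)
  define w where "w = of_int r * (- (?\<pi> ^ (d - 1)) - of_nat p * t)
    + of_int s * (?\<pi> ^ (d - Suc i0) * A - (1 + ?\<pi> * t) * B - t * of_int e)"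
  have "w \<in> int_adjoin z"
    unfolding w_def
    by (intro int_adjoin_mult int_adjoin_uminus int_adjoin_add int_adjoin_diff int_adjoin_power
        t(1) AB int_adjoin_self int_adjoin_of_int int_adjoin_of_nat int_adjoin_0_1)
  moreover have "?\<pi> * w = of_int r * of_nat p + of_int s * of_int e"
    unfolding w_def distrib_left mult.left_commute[of ?\<pi>] p\<pi>[symmetric] e\<pi>[symmetric] ..
  ultimately show False
    using inverse_not_in_int_adjoin \<open>of_int r * of_nat p + of_int s * of_int e = (1::complex)\<close> by metis
qed

lemma sum_split: "(\<Sum>i<N. f i) = (\<Sum>k<p. \<Sum>j<M. f (j + k * M))"
  for f :: "nat \<Rightarrow> 'b::comm_monoid_add"
proof -
  have "(\<Sum>i<N. f i) = (\<Sum>k<p. sum f {k * M..<k * M + M})"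
    unfolding N_eq by (rule sum.nat_group[symmetric])
  moreover have "sum f {k * M..<k * M + M} = (\<Sum>j<M. f (j + k * M))" for k
    using sum.shift_bounds_nat_ivl[of f 0 "k * M" M] by (simp add: atLeast0LessThan add.commute)
  ultimately show ?thesis by simp
qed

text \<open>These relations are the combinations of \<open>sum_root_powers\<close> multiplied by
  \<open>z ^ j\<close> for \<open>j < M\<close>; the next lemma shows that there are no
  others.\<close>

lemma sum_mod_coeffs: "(\<Sum>i<N. of_int (c (i mod M)) * z ^ i) = 0"
proof -
  have "(\<Sum>i<N. of_int (c (i mod M)) * z ^ i)
      = (\<Sum>k<p. \<Sum>j<M. of_int (c j) * z ^ j * z ^ (k * M))"
    unfolding sum_split by (intro sum.cong refl) (simp add: power_add)
  also have "\<dots> = (\<Sum>j<M. of_int (c j) * z ^ j * (\<Sum>k<p. z ^ (k * M)))"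
    by (subst sum.swap) (simp add: sum_distrib_left)
  finally show ?thesis by (simp add: sum_root_powers)
qed

text \<open>Subtracting the relation with coefficients \<open>c (d + i mod M)\<close> clears the top
  \<open>M\<close> positions, because \<open>M\<close> divides \<open>d\<close>. What remains has
  degree below \<open>d\<close> and a root \<open>z\<close>, so it is 0.\<close>

lemma coeffs_eq_of_sum_eq_0:
  assumes "(\<Sum>i<N. of_int (c i) * z ^ i) = 0" and "i < N"
  shows "c i = c (d + i mod M)"
proof -
  define f where "f = (\<Sum>i<N. monom (c i - c (d + i mod M)) i)"
  have coeff_f: "coeff f i = (if i < N then c i - c (d + i mod M) else 0)" for i
    by (simp add: f_def coeff_sum)
  have "poly (of_int_poly f) z = (\<Sum>i<N. of_int (c i) * z ^ i) - (\<Sum>i<N. of_int (c (d + i mod M)) * z ^ i)"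
    by (simp add: f_def hom_distribs poly_sum poly_monom sum_subtractf left_diff_distrib)
  also have "\<dots> = 0"
    using assms(1) sum_mod_coeffs[of "\<lambda>j. c (d + j)"] by simp
  finally have "poly (of_int_poly f) z = 0" .
  moreover have "degree f < d"
  proof -
    have "coeff f i = 0" if "i \<ge> d" for i
    proof (cases "i < N")
      case True
      have "i = d + (i - d)" using that by simp
      moreover have "(i - d) mod M = i - d" using True that by (intro mod_less) (simp add: N_eq_add)
      moreover have "(d + (i - d)) mod M = (i - d) mod M" by simp
      ultimately have "d + i mod M = i" by metis
      then show ?thesis by (simp add: coeff_f)
    qed (simp add: coeff_f)
    moreover have "d > 0" using p_gt_1 M_pos by simp
    ultimately show ?thesis by (metis degree_0 leading_coeff_0_iff leI)
  qed
  ultimately have "f = 0" by (rule eq_0_if_root)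
  then show ?thesis using coeff_f[of i] assms(2) by simp
qed

end

section \<open>Cyclic sums and integer inequalities\<close>

lemma sum_rotate:
  fixes f :: "nat \<Rightarrow> 'b::comm_monoid_add"
  shows "(\<Sum>k<m. f ((s + k) mod m)) = (\<Sum>k<m. f k)"
proof (cases "m = 0")
  case False
  have inj: "inj_on (\<lambda>k. (s + k) mod m) {..<m}"
  proof (rule inj_onI)
    fix x y assume "x \<in> {..<m}" "y \<in> {..<m}" "(s + x) mod m = (s + y) mod m"
    then have "[s + x = s + y] (mod m)" by (simp add: cong_def)
    then have "[x = y] (mod m)" by (simp only: cong_add_lcancel_nat)
    then show "x = y" using \<open>x \<in> {..<m}\<close> \<open>y \<in> {..<m}\<close> by (simp add: cong_def)
  qed
  moreover have "(\<lambda>k. (s + k) mod m) ` {..<m} = {..<m}"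
    by (rule endo_inj_surj[OF _ _ inj]) (use False in auto)
  ultimately have "bij_betw (\<lambda>k. (s + k) mod m) {..<m} {..<m}"
    by (simp add: bij_betw_def)
  then show ?thesis by (rule sum.reindex_bij_betw)
qed simp

lemma sum_power2_le_power2_sum:
  fixes f :: "'i \<Rightarrow> int"
  assumes "\<And>i. i \<in> A \<Longrightarrow> 0 \<le> f i"
  shows "(\<Sum>i\<in>A. (f i)\<^sup>2) \<le> (\<Sum>i\<in>A. f i)\<^sup>2"
  using assms
proof (induction A rule: infinite_finite_induct)
  case (insert x A)
  have "0 \<le> f x * (\<Sum>i\<in>A. f i)" using insert.prems by (intro mult_nonneg_nonneg sum_nonneg) auto
  then show ?case using insert by (simp add: power2_sum)
qed (simp_all add: zero_power)

text \<open>The quotient \<open>(2 * s + p) div (2 * p)\<close> is \<open>s / p\<close> rounded to a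
  nearest integer.\<close>

lemma nearest_multiple:
  fixes s :: int
  assumes "p > 0"
  shows "2 * \<bar>s - p * ((2 * s + p) div (2 * p))\<bar> \<le> p"
proof -
  define k r where "k = p * ((2 * s + p) div (2 * p))" and "r = (2 * s + p) mod (2 * p)"
  have "r \<ge> 0" "r < 2 * p" using assms by (simp_all add: r_def)
  moreover have "2 * s + p = 2 * k + r"
    unfolding k_def r_def by (metis mult_div_mod_eq mult.assoc)
  ultimately have "2 * \<bar>s - k\<bar> \<le> p" by arith
  then show ?thesis by (simp only: k_def)
qed

text \<open>For \<open>\<mu> = 1\<close> the last assumption is the claim itself. In general
  \<open>(n + \<mu>)\<^sup>2 - n\<close> exceeds \<open>(n\<^sup>2 + n + 1) * \<mu>\<close> by a
  quadratic in \<open>\<mu>\<close> with roots 1 and \<open>n\<^sup>2 - n\<close>, and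
  \<open>\<mu> \<le> n\<close> keeps \<open>\<mu>\<close> between them.\<close>

lemma quadratic_bound_of_excess:
  fixes n \<mu> p :: int
  assumes "n \<ge> 2" "\<mu> \<ge> 1" "\<mu> \<le> n" "n + p * \<mu> \<le> (n + \<mu>)\<^sup>2"
  shows "p \<le> n\<^sup>2 + n + 1"
proof -
  have "(\<mu> - 1) * (\<mu> - (n\<^sup>2 - n)) \<le> 0"
  proof -
    have "n \<le> n\<^sup>2 - n \<or> n = 2 \<and> n\<^sup>2 - n = 2"
      using assms(1) by (auto simp: power2_eq_square algebra_simps)
    then show ?thesis using assms by (intro mult_nonneg_nonpos) auto
  qed
  then have "p * \<mu> \<le> (n\<^sup>2 + n + 1) * \<mu>"
    using assms(4) by (simp add: power2_eq_square algebra_simps)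
  then show ?thesis using assms(2) by simp
qed

section \<open>Autocorrelation of the coefficients and the bound for the prime\<close>

context prime_power_root_of_unity
begin

lemma cnj_z: "cnj z * z = 1"
  by (rule cnj_mult_root_of_unity[OF root N_pos])

lemma power_mod_N: "z ^ (i mod N) = z ^ i"
  using root by (metis div_mult_mod_eq mult.commute mult_1 power_add power_mult power_one)

text \<open>The image of \<open>c\<close> under the map of group rings from Z[Z/N] to
  Z[Z/M].\<close>

definition coset_sum :: "(nat \<Rightarrow> int) \<Rightarrow> nat \<Rightarrow> int" where
  "coset_sum c j = (\<Sum>k<p. c (j + k * M))"

definition autocorrelation :: "(nat \<Rightarrow> int) \<Rightarrow> nat \<Rightarrow> int" where
  "autocorrelation c t = (\<Sum>i<N. c i * c ((i + t) mod N))"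

lemma sum_coset_shift: "(\<Sum>k<p. c ((s + k * M) mod N)) = coset_sum c (s mod M)"
proof -
  have "(s + k * M) mod N = s mod M + ((s div M + k) mod p) * M" for k
  proof -
    have "s + k * M = s mod M + M * (s div M + k)" by (simp add: algebra_simps)
    then have "(s + k * M) mod N = (s mod M + M * (s div M + k)) mod (M * p)"
      by (simp add: N_eq mult.commute)
    also have "\<dots> = M * ((s mod M + M * (s div M + k)) div M mod p) + (s mod M + M * (s div M + k)) mod M"
      by (rule mod_mult2_eq)
    also have "\<dots> = s mod M + ((s div M + k) mod p) * M"
      using M_pos by simp
    finally show ?thesis .
  qed
  then show ?thesis
    unfolding coset_sum_def by (simp add: sum_rotate[of "\<lambda>k. c (s mod M + k * M)"])
qed

text \<open>By \<open>sum_mod_coeffs\<close>, any function of \<open>i mod M\<close> may be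
  subtracted from the coefficients, which changes each coset sum by a multiple of \<open>p\<close>
  of one's choice.\<close>

lemma normalized_coeffs:
  assumes "x \<in> int_adjoin z"
  obtains c :: "nat \<Rightarrow> int" where "x = (\<Sum>i<N. of_int (c i) * z ^ i)"
    "\<And>j. j < M \<Longrightarrow> 2 * \<bar>coset_sum c j\<bar> \<le> int p"
proof -
  obtain c where c: "x = (\<Sum>i<N. of_int (c i) * z ^ i)"
    using int_adjoin_as_sum[OF root N_pos assms] .
  define r where "r = (\<lambda>j. (2 * coset_sum c j + int p) div (2 * int p))"
  define c' where "c' = (\<lambda>i. c i - r (i mod M))"
  have "(\<Sum>i<N. of_int (c' i) * z ^ i) = x"
    using sum_mod_coeffs[of r] by (simp add: c'_def c left_diff_distrib sum_subtractf)
  moreover have "2 * \<bar>coset_sum c' j\<bar> \<le> int p" if "j < M" for j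
  proof -
    have "coset_sum c' j = coset_sum c j - int p * r j"
      using that by (simp add: coset_sum_def c'_def sum_subtractf)
    then show ?thesis using nearest_multiple[of "int p" "coset_sum c j"] p_gt_1 by (simp add: r_def)
  qed
  ultimately show ?thesis by (intro that[of c']) auto
qed

text \<open>The map from Z[Z/N] to Z[Z/M] respects products and inversion, hence
  autocorrelations.\<close>

lemma sum_autocorrelation_coset:
  "(\<Sum>k<p. autocorrelation c (t + k * M)) = (\<Sum>j<M. coset_sum c j * coset_sum c ((j + t) mod M))"
proof -
  have "(\<Sum>k<p. autocorrelation c (t + k * M)) = (\<Sum>i<N. c i * (\<Sum>k<p. c ((i + t + k * M) mod N)))"
    unfolding autocorrelation_def by (subst sum.swap) (simp add: sum_distrib_left add.assoc)
  also have "\<dots> = (\<Sum>i<N. c i * coset_sum c ((i + t) mod M))"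
    by (simp add: sum_coset_shift)
  also have "\<dots> = (\<Sum>k<p. \<Sum>j<M. c (j + k * M) * coset_sum c ((j + t) mod M))"
    unfolding sum_split
    by (intro sum.cong refl arg_cong2[of _ _ _ _ "(*)"] arg_cong[of _ _ "coset_sum c"])
      (metis add.commute add.left_commute mod_mult_self1 mult.commute)
  also have "\<dots> = (\<Sum>j<M. coset_sum c j * coset_sum c ((j + t) mod M))"
    by (subst sum.swap) (simp add: coset_sum_def sum_distrib_right)
  finally show ?thesis .
qed

lemma mult_cnj_eq_sum_autocorrelation:
  assumes "x = (\<Sum>i<N. of_int (c i) * z ^ i)"
  shows "x * cnj x = (\<Sum>t<N. of_int (autocorrelation c t) * z ^ t)"
proof -
  \<comment> \<open>The sum for \<open>x\<close> is rotated separately for each term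
    \<open>i\<close> of \<open>cnj x\<close>, so that the products are already sorted by the
    difference \<open>t\<close> of the exponents.\<close>
  have x_i: "x = (\<Sum>t<N. of_int (c ((i + t) mod N)) * z ^ (i + t))" for i
    unfolding assms sum_rotate[of "\<lambda>k. of_int (c k) * z ^ k" i N, symmetric]
    by (simp only: power_mod_N)
  have zi: "cnj (z ^ i) * z ^ (i + t) = z ^ t" for i t
  proof -
    have "cnj (z ^ i) * z ^ (i + t) = (cnj z * z) ^ i * z ^ t"
      by (simp add: power_add power_mult_distrib)
    then show ?thesis by (simp add: cnj_z)
  qed
  have cnj_x: "cnj x = (\<Sum>i<N. of_int (c i) * cnj (z ^ i))"
    unfolding assms by simp
  have "x * cnj x = cnj x * x" by (rule mult.commute)
  also have "\<dots> = (\<Sum>i<N. of_int (c i) * cnj (z ^ i) * x)"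
    by (subst cnj_x) (rule sum_distrib_right)
  also have "\<dots> = (\<Sum>i<N. \<Sum>t<N. of_int (c i * c ((i + t) mod N)) * z ^ t)"
  proof (rule sum.cong[OF refl])
    fix i
    have "of_int (c i) * cnj (z ^ i) * x
        = of_int (c i) * cnj (z ^ i) * (\<Sum>t<N. of_int (c ((i + t) mod N)) * z ^ (i + t))"
      by (rule arg_cong[OF x_i])
    also have "\<dots> = (\<Sum>t<N. of_int (c i * c ((i + t) mod N)) * (cnj (z ^ i) * z ^ (i + t)))"
      unfolding sum_distrib_left of_int_mult by (intro sum.cong refl) (simp only: mult_ac)
    finally show "of_int (c i) * cnj (z ^ i) * x = (\<Sum>t<N. of_int (c i * c ((i + t) mod N)) * z ^ t)"
      unfolding zi .
  qed
  also have "\<dots> = (\<Sum>t<N. of_int (autocorrelation c t) * z ^ t)"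
    by (subst sum.swap) (simp add: autocorrelation_def sum_distrib_right)
  finally show ?thesis .
qed

text \<open>The autocorrelation \<open>A\<close> of the coefficients of \<open>x\<close> minus \<open>n\<close> at \<open>0\<close> represents \<open>0\<close>, hence is
  constant on the cosets of the subgroup of order \<open>p\<close>. Its value \<open>\<mu>\<close> at \<open>0\<close> is compared with the
  autocorrelation of the coset sums \<open>S\<close>. If \<open>\<mu> = 0\<close> and \<open>n < p\<close>, the latter vanishes off \<open>0\<close>, which
  makes \<open>n\<close> the square of the total sum. If \<open>\<mu> > 0\<close>, the sum of the squares of \<open>S\<close>, which is
  \<open>n + p * \<mu>\<close>, is at most the square of the sum of the \<open>\<bar>S j\<bar>\<close>, hence at most \<open>(n + \<mu>)\<^sup>2\<close>.\<close>

theorem prime_le_of_norm_nonsquare: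
  assumes x: "x \<in> int_adjoin z" and norm: "x * cnj x = of_int n"
    and nonsquare: "\<And>s. n \<noteq> s\<^sup>2"
  shows "int p \<le> n\<^sup>2 + n + 1"
proof -
  have "real_of_int n = (cmod x)\<^sup>2"
    using norm by (metis complex_norm_square of_real_eq_iff of_real_of_int_eq)
  then have "n \<ge> 0" by (metis of_int_0_le_iff zero_le_power2)
  moreover have "n \<noteq> 0" "n \<noteq> 1" using nonsquare[of 0] nonsquare[of 1] by auto
  ultimately have n2: "n \<ge> 2" by simp
  obtain c where c: "x = (\<Sum>i<N. of_int (c i) * z ^ i)"
    and small: "\<And>j. j < M \<Longrightarrow> 2 * \<bar>coset_sum c j\<bar> \<le> int p"
    using normalized_coeffs[OF x] by blast
  define A where "A = autocorrelation c"
  define S where "S = coset_sum c"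
  define T where "T = (\<lambda>t. \<Sum>j<M. S j * S ((j + t) mod M))"
  define E where "E = (\<lambda>t. A t - (if t = 0 then n else 0))"
  have "(\<Sum>t<N. of_int (E t) * z ^ t) = x * cnj x - (\<Sum>t<N. of_int (if t = 0 then n else 0) * z ^ t)"
    unfolding mult_cnj_eq_sum_autocorrelation[OF c] E_def A_def
    by (simp add: left_diff_distrib sum_subtractf)
  also have "(\<Sum>t<N. of_int (if t = 0 then n else 0) * z ^ t) = of_int n"
  proof -
    have "(\<Sum>t<N. of_int (if t = 0 then n else 0) * z ^ t) = (\<Sum>t<N. if t = 0 then of_int n else 0)"
      by (intro sum.cong) auto
    then show ?thesis using N_pos by simp
  qed
  finally have "(\<Sum>t<N. of_int (E t) * z ^ t) = 0" using norm by simp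
  then have E_const: "E t = E (d + t mod M)" if "t < N" for t
    using coeffs_eq_of_sum_eq_0 that by blast
  have E_coset: "E (t + k * M) = E t" if "t < M" "k < p" for t k
  proof -
    have "t + k * M < M + k * M" using that by simp
    also have "\<dots> \<le> N" using that(2) mult_le_mono1[of "Suc k" p M] by (simp add: N_eq)
    finally have "t + k * M < N" .
    moreover have "t < N" using that p_gt_1 by (simp add: N_eq_add)
    ultimately show ?thesis using E_const[of t] E_const[of "t + k * M"] by simp
  qed
  define \<mu> where "\<mu> = E 0"
  have T_eq: "T t = int p * E t + (if t = 0 then n else 0)" if "t < M" for t
  proof -
    have "T t = (\<Sum>k<p. A (t + k * M))"
      unfolding T_def S_def A_def sum_autocorrelation_coset ..
    also have "\<dots> = (\<Sum>k<p. E t + (if t = 0 \<and> k = 0 then n else 0))"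
    proof (rule sum.cong[OF refl])
      fix k assume "k \<in> {..<p}"
      then have "A (t + k * M) = E t + (if t + k * M = 0 then n else 0)"
        using E_coset[OF that, of k] by (simp add: E_def)
      then show "A (t + k * M) = E t + (if t = 0 \<and> k = 0 then n else 0)"
        using M_pos by simp
    qed
    also have "\<dots> = int p * E t + (\<Sum>k<p. if t = 0 \<and> k = 0 then n else 0)"
      by (simp add: sum.distrib)
    also have "(\<Sum>k<p. if t = 0 \<and> k = 0 then n else 0) = (if t = 0 then n else 0)"
      using p_gt_1 by simp
    finally show ?thesis .
  qed
  have T0: "(\<Sum>j<M. (S j)\<^sup>2) = n + int p * \<mu>"
    using T_eq[OF M_pos] by (simp add: T_def \<mu>_def power2_eq_square)
  have A0: "(\<Sum>i<N. (c i)\<^sup>2) = n + \<mu>"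
    by (simp add: \<mu>_def E_def A_def autocorrelation_def power2_eq_square)
  have "(\<Sum>j<M. \<bar>S j\<bar>) \<le> (\<Sum>j<M. \<Sum>k<p. \<bar>c (j + k * M)\<bar>)"
    unfolding S_def coset_sum_def by (intro sum_mono sum_abs)
  also have "\<dots> = (\<Sum>i<N. \<bar>c i\<bar>)"
    unfolding sum_split by (rule sum.swap)
  \<comment> \<open>Here the coefficients have to be integers.\<close>
  also have "\<dots> \<le> (\<Sum>i<N. (c i)\<^sup>2)"
  proof (rule sum_mono)
    fix i
    show "\<bar>c i\<bar> \<le> (c i)\<^sup>2"
      using mult_right_mono[of 1 "\<bar>c i\<bar>" "\<bar>c i\<bar>"]
      by (cases "c i = 0") (auto simp: power2_eq_square abs_mult[symmetric])
  qed
  finally have L1: "(\<Sum>j<M. \<bar>S j\<bar>) \<le> n + \<mu>" using A0 by simp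
  consider "\<mu> < 0" | "\<mu> = 0" | "\<mu> \<ge> 1" by linarith
  then show ?thesis
  proof cases
    case 1
    \<comment> \<open>A negative \<open>\<mu>\<close> forces \<open>p \<le> n\<close>, since a sum
      of squares is not negative.\<close>
    have "0 \<le> n + int p * \<mu>" unfolding T0[symmetric] by (intro sum_nonneg) auto
    moreover have "int p * \<mu> \<le> int p * (- 1)" using 1 by (intro mult_left_mono) auto
    moreover have "n\<^sup>2 \<ge> 0" by simp
    ultimately show ?thesis by linarith
  next
    case 2
    show ?thesis
    proof (rule ccontr)
      assume "\<not> ?thesis"
      moreover have "n\<^sup>2 \<ge> 0" by simp
      ultimately have pn: "int p > n" by linarith
      \<comment> \<open>Off 0, \<open>T t\<close> is a multiple of \<open>p\<close>, and by the
        inequality between the means it is bounded by the value \<open>n\<close> at 0, which is less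
        than \<open>p\<close>.\<close>
      have T_vanish: "T t = 0" if t: "0 < t" "t < M" for t
      proof -
        have "2 * \<bar>x * y\<bar> \<le> x\<^sup>2 + y\<^sup>2" for x y :: int
          using zero_le_power2[of "\<bar>x\<bar> - \<bar>y\<bar>"] by (simp add: power2_diff abs_mult)
        then have "(\<Sum>j<M. 2 * \<bar>S j * S ((j + t) mod M)\<bar>) \<le>
            (\<Sum>j<M. (S j)\<^sup>2 + (S ((j + t) mod M))\<^sup>2)"
          by (intro sum_mono)
        also have "\<dots> = (\<Sum>j<M. (S j)\<^sup>2) + (\<Sum>j<M. (S ((t + j) mod M))\<^sup>2)"
          by (simp add: sum.distrib add.commute)
        also have "\<dots> = 2 * n"
          using T0 2 by (simp add: sum_rotate[of "\<lambda>j. (S j)\<^sup>2"])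
        finally have "(\<Sum>j<M. \<bar>S j * S ((j + t) mod M)\<bar>) \<le> n"
          by (simp add: sum_distrib_left[symmetric])
        then have "\<bar>T t\<bar> \<le> n"
          unfolding T_def using sum_abs[of "\<lambda>j. S j * S ((j + t) mod M)" "{..<M}"] by linarith
        moreover have "T t = int p * E t" using T_eq[of t] t by simp
        moreover have "\<bar>T t\<bar> \<ge> int p" if "E t \<noteq> 0"
        proof -
          have "int p * 1 \<le> int p * \<bar>E t\<bar>" using that by (intro mult_left_mono) auto
          then show ?thesis using \<open>T t = int p * E t\<close> by (simp add: abs_mult)
        qed
        ultimately show ?thesis using pn by (cases "E t = 0") auto
      qed
      have "(\<Sum>j<M. S j)\<^sup>2 = (\<Sum>j<M. S j * (\<Sum>t<M. S ((j + t) mod M)))"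
        by (simp add: sum_rotate power2_eq_square sum_distrib_right)
      also have "\<dots> = (\<Sum>t<M. T t)"
        unfolding T_def sum_distrib_left by (rule sum.swap)
      also have "\<dots> = (\<Sum>t<M. if t = 0 then n else 0)"
        using T_vanish T_eq[OF M_pos] 2 by (intro sum.cong) (auto simp: \<mu>_def)
      also have "\<dots> = n" using M_pos by simp
      finally show False using nonsquare by metis
    qed
  next
    case 3
    \<comment> \<open>The normalization of the coset sums enters here. It yields
      \<open>\<mu> \<le> n\<close>, which the quadratic estimate requires.\<close>
    have "2 * (n + int p * \<mu>) = (\<Sum>j<M. 2 * \<bar>S j\<bar> * \<bar>S j\<bar>)"
      unfolding T0[symmetric] sum_distrib_left
      by (intro sum.cong refl) (simp add: power2_eq_square mult.assoc)
    also have "\<dots> \<le> (\<Sum>j<M. int p * \<bar>S j\<bar>)"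
    proof (rule sum_mono)
      fix j assume "j \<in> {..<M}"
      then have "2 * \<bar>S j\<bar> \<le> int p" using small by (simp add: S_def)
      then show "2 * \<bar>S j\<bar> * \<bar>S j\<bar> \<le> int p * \<bar>S j\<bar>" by (rule mult_right_mono) simp
    qed
    also have "\<dots> \<le> int p * (n + \<mu>)"
      unfolding sum_distrib_left[symmetric] using L1 by (rule mult_left_mono) simp
    finally have "int p * \<mu> \<le> int p * n"
      using n2 by (simp add: algebra_simps)
    then have "\<mu> \<le> n" using p_gt_1 by simp
    moreover have "n + int p * \<mu> \<le> (n + \<mu>)\<^sup>2"
    proof -
      have "n + int p * \<mu> = (\<Sum>j<M. \<bar>S j\<bar>\<^sup>2)" using T0 by simp
      also have "\<dots> \<le> (\<Sum>j<M. \<bar>S j\<bar>)\<^sup>2" by (rule sum_power2_le_power2_sum) simp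
      also have "\<dots> \<le> (n + \<mu>)\<^sup>2" by (rule power_mono[OF L1]) (simp add: sum_nonneg)
      finally show ?thesis .
    qed
    ultimately show ?thesis by (rule quadratic_bound_of_excess[OF n2 3])
  qed
qed

text \<open>Integrality of \<open>r\<close> is derived here, from \<open>r\<close> being a rational
  element of Z[z]. It is not known beforehand for \<open>lam / q ^ (b + 1)\<close> with
  \<open>b\<close> odd, nor for a quarter of the integer
  \<open>4 * lam / (b^2 - a^2)\<close>.\<close>

corollary prime_le_of_rational_norm:
  assumes x: "x \<in> int_adjoin z" and norm: "x * cnj x = of_real r" and r: "r \<in> \<rat>"
    and nonsquare: "\<And>s::int. r \<noteq> (of_int s)\<^sup>2"
  shows "real p \<le> r\<^sup>2 + r + 1"
proof -
  have "x * cnj x \<in> int_adjoin z"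
    by (intro int_adjoin_mult int_adjoin_cnj[OF root N_pos] x)
  then have "algebraic_int (x * cnj x)" by (rule algebraic_int_int_adjoin[OF root N_pos])
  moreover have "x * cnj x \<in> \<rat>" using r by (auto simp: norm elim!: Rats_cases)
  ultimately have "x * cnj x \<in> \<int>" by (rule rational_algebraic_int_is_int)
  then obtain n where n: "x * cnj x = of_int n" by (elim Ints_cases)
  then have rn: "r = of_int n" using norm by (metis of_real_eq_iff of_real_of_int_eq)
  have "n \<noteq> s\<^sup>2" for s using nonsquare[of s] by (auto simp: rn)
  then have "int p \<le> n\<^sup>2 + n + 1" by (rule prime_le_of_norm_nonsquare[OF x n])
  then have "real_of_int (int p) \<le> real_of_int (n\<^sup>2 + n + 1)" by (simp only: of_int_le_iff)
  then show ?thesis by (simp add: rn)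
qed

section \<open>Divisibility in Z[z] by self-conjugate primes and by denominators\<close>

lemma self_conjugate_power_dvd:
  assumes q: "prime q" and qr: "[int q ^ r = - 1] (mod int N)" and N: "N > 2"
    and x: "x \<in> int_adjoin z" "x * cnj x = of_nat L" and b: "q ^ b dvd L"
  shows "\<exists>w\<in>int_adjoin z. x = of_nat q ^ ((b + 1) div 2) * w"
  using x b
proof (induction b arbitrary: x L rule: less_induct)
  case (less b)
  show ?case
  proof (cases "b = 0")
    case True
    then show ?thesis using less.prems by simp
  next
    case False
    have q0: "q > 0" using q prime_gt_0_nat by blast
    have "q dvd L" using less.prems(3) False by (meson dvd_power dvd_trans neq0_conv)
    then obtain L' where "L = q * L'" by (elim dvdE)
    then have "x * cnj x = of_nat q * of_nat L'" using less.prems(2) by simp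
    then obtain w where w: "w \<in> int_adjoin z" "x = of_nat q * w"
      using self_conjugate_dvd[OF root N q qr less.prems(1)] by (metis int_adjoin_of_nat)
    show ?thesis
    \<comment> \<open>A single factor \<open>q\<close> of the squared modulus still yields a full
      factor \<open>q\<close> of \<open>x\<close>, while every other step uses up
      \<open>q ^ 2\<close>. Hence the exponent is \<open>b / 2\<close> rounded up.\<close>
    proof (cases "b = 1")
      case True
      then show ?thesis using w by (intro bexI[of _ w]) simp_all
    next
      case b1: False
      define b' where "b' = b - 2"
      have b: "b = b' + 2" using False b1 by (simp add: b'_def)
      obtain K where K: "L = q ^ b * K" using less.prems(3) by (elim dvdE)
      have "of_nat q ^ 2 * (w * cnj w) = of_nat q ^ 2 * of_nat (q ^ b' * K)"
        using less.prems(2) unfolding w(2) K b by (simp add: power2_eq_square power_add mult_ac)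
      then have "w * cnj w = of_nat (q ^ b' * K)" using q0 by simp
      then obtain y where y: "y \<in> int_adjoin z" "w = of_nat q ^ ((b' + 1) div 2) * y"
        using less.IH[of b' w "q ^ b' * K"] w(1) b by auto
      have "(b + 1) div 2 = Suc ((b' + 1) div 2)" unfolding b by simp
      then show ?thesis using y w(2) by (intro bexI[of _ y]) (simp_all add: mult_ac)
    qed
  qed
qed

lemma prime_le_of_self_conjugate:
  assumes q: "prime q" and qr: "[int q ^ r = - 1] (mod int N)" and N: "N > 2"
    and x: "x \<in> int_adjoin z" "x * cnj x = of_nat L" and b: "q ^ b dvd L"
    and nonsquare: "\<And>s::int. real L \<noteq> (of_int s)\<^sup>2"
  shows "real p \<le> (real L / real q ^ (2 * ((b + 1) div 2)))\<^sup>2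
    + real L / real q ^ (2 * ((b + 1) div 2)) + 1"
proof -
  define c where "c = (b + 1) div 2"
  obtain w where w: "w \<in> int_adjoin z" "x = of_nat q ^ c * w"
    using self_conjugate_power_dvd[OF q qr N x b] unfolding c_def by blast
  have q0: "real q > 0" using q prime_gt_0_nat by simp
  then have qc: "(of_nat q :: complex) ^ (2 * c) \<noteq> 0" by simp
  have "of_nat q ^ (2 * c) * (w * cnj w) = of_nat L"
    using x(2) unfolding w(2) by (simp add: power_mult power2_eq_square power_mult_distrib mult_ac)
  then have "w * cnj w = of_real (real L / real q ^ (2 * c))"
    using qc by (simp add: field_simps)
  moreover have "real L / real q ^ (2 * c) \<noteq> (of_int s)\<^sup>2" for s
  proof
    assume "real L / real q ^ (2 * c) = (of_int s)\<^sup>2"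
    then have "real L = (of_int (s * int q ^ c))\<^sup>2"
      using q0 by (simp add: field_simps power_mult power_mult_distrib power2_eq_square)
    then show False using nonsquare by blast
  qed
  ultimately show ?thesis
    unfolding c_def[symmetric] by (intro prime_le_of_rational_norm[OF w(1)]) auto
qed

text \<open>Bezout's identity makes \<open>y / f\<close> an integer combination of
  \<open>y * e / f\<close> and \<open>y\<close>.\<close>

lemma divide_in_int_adjoin:
  assumes "y \<in> int_adjoin z" "y * of_int e / of_int f \<in> int_adjoin z" "coprime e f" "f \<noteq> 0"
  shows "y / of_int f \<in> int_adjoin z"
proof -
  obtain u v where "u * e + v * f = 1"
    using assms(3) bezout_int[of e f] by (auto simp: coprime_iff_gcd_eq_1)
  then have "of_int u * of_int e + of_int v * of_int f = (1::complex)"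
    by (metis of_int_1 of_int_add of_int_mult)
  then have "y / of_int f = (of_int u * of_int e + of_int v * of_int f) * y / of_int f" by simp
  also have "\<dots> = of_int u * (y * of_int e / of_int f) + of_int v * y"
    using assms(4) by (simp add: field_simps)
  finally show ?thesis using assms(1,2) by (metis int_adjoin_add int_adjoin_mult int_adjoin_of_int)
qed

lemma prime_le_of_coprime_ratio:
  assumes y: "y \<in> int_adjoin z" and ratio: "y * of_int e / of_int f \<in> int_adjoin z"
    and ef: "coprime e f" "f \<noteq> 0" and r: "(cmod y)\<^sup>2 = r * (of_int f)\<^sup>2" "r \<in> \<rat>"
    and nonsquare: "\<And>s::int. r \<noteq> (of_int s)\<^sup>2"
  shows "real p \<le> r\<^sup>2 + r + 1"
proof (rule prime_le_of_rational_norm[OF divide_in_int_adjoin[OF y ratio ef] _ r(2) nonsquare])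
  have "y * cnj y = of_real r * (of_int f)\<^sup>2"
    unfolding complex_norm_square[symmetric] r(1) by simp
  then show "y / of_int f * cnj (y / of_int f) = of_real r"
    using ef(2) by (simp add: power2_eq_square field_simps)
qed

end

section \<open>Characters of finite groups and their values on the blocks\<close>

lemma prime_power_root_of_unity_cis:
  assumes "prime p"
  shows "prime_power_root_of_unity p l (p * p ^ l) (p ^ l) (cis (2 * pi / real (p * p ^ l)))"
proof
  have p: "p > 1" using assms prime_gt_1_nat by blast
  let ?z = "cis (2 * pi / real (p * p ^ l))"
  show "?z ^ (p * p ^ l) = 1" using p by (simp add: DeMoivre)
  have "?z ^ (p ^ l) = cis (2 * pi * real 1 / real p)" using p by (simp add: DeMoivre)
  moreover have "inj_on (\<lambda>k. cis (2 * pi * real k / real p)) {..<p}"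
    using bij_betw_roots_unity[of p] p by (simp add: bij_betw_def)
  then have "cis (2 * pi * real 1 / real p) \<noteq> cis (2 * pi * real 0 / real p)"
    using p inj_onD[of "\<lambda>k. cis (2 * pi * real k / real p)" "{..<p}" 1 0] by fastforce
  ultimately show "?z ^ (p ^ l) \<noteq> 1" by simp
qed (use assms in auto)

lemma root_of_unity_in_int_adjoin_cis:
  assumes "w ^ n = 1" "n > 0"
  shows "w \<in> int_adjoin (cis (2 * pi / real n))"
proof -
  obtain k where "w = cis (2 * pi * real k / real n)"
    using bij_betw_roots_unity[OF assms(2)] assms(1) by (auto simp: bij_betw_def)
  then have "w = cis (2 * pi / real n) ^ k" by (simp add: DeMoivre mult_ac)
  then show ?thesis by (simp add: int_adjoin_power)
qed

locale finite_group_character = group G for G (structure) +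
  fixes \<chi> :: "'a \<Rightarrow> complex"
  assumes finite_carrier: "finite (carrier G)" and character: "is_character G \<chi>"
begin

lemma chi_mult: "x \<in> carrier G \<Longrightarrow> y \<in> carrier G \<Longrightarrow> \<chi> (x \<otimes> y) = \<chi> x * \<chi> y"
  and chi_nonzero: "x \<in> carrier G \<Longrightarrow> \<chi> x \<noteq> 0"
  using character by (auto simp: is_character_def hom_def complex_mult_group_def)

lemma chi_one: "\<chi> \<one> = 1"
  using chi_mult[of \<one> \<one>] chi_nonzero[of \<one>] by simp

lemma chi_pow: "x \<in> carrier G \<Longrightarrow> \<chi> (x [^] (n::nat)) = \<chi> x ^ n"
  by (induction n) (simp_all add: chi_one chi_mult)

lemma order_pos: "order G > 0"
  using finite_carrier by (simp add: order_gt_0_iff_finite)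

lemma chi_power_order: "x \<in> carrier G \<Longrightarrow> \<chi> x ^ order G = 1"
  using chi_pow[of x "order G"] pow_order_eq_1[of x] by (simp add: chi_one)

lemma character_order_pos: "character_order G \<chi> > 0"
  and chi_power_character_order: "x \<in> carrier G \<Longrightarrow> \<chi> x ^ character_order G \<chi> = 1"
proof -
  have "character_order G \<chi> > 0 \<and> (\<forall>x\<in>carrier G. \<chi> x ^ character_order G \<chi> = 1)"
    unfolding character_order_def
    by (rule LeastI[of _ "order G"]) (use order_pos chi_power_order in blast)
  then show "character_order G \<chi> > 0" "x \<in> carrier G \<Longrightarrow> \<chi> x ^ character_order G \<chi> = 1" by auto
qed

lemma chi_inv: "x \<in> carrier G \<Longrightarrow> \<chi> (inv x) = cnj (\<chi> x)"
proof -
  assume x: "x \<in> carrier G"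
  have "cnj (\<chi> x) * \<chi> x = 1"
    using chi_power_order[OF x] order_pos by (rule cnj_mult_root_of_unity)
  moreover have "\<chi> (inv x) * \<chi> x = 1" using x chi_mult[of "inv x" x] chi_one by simp
  ultimately show ?thesis using chi_nonzero[OF x] by (metis mult_right_cancel)
qed

lemma sum_chi_carrier:
  assumes "nonprincipal G \<chi>"
  shows "(\<Sum>x\<in>carrier G. \<chi> x) = 0"
proof -
  obtain g where g: "g \<in> carrier G" "\<chi> g \<noteq> 1" using assms by (auto simp: nonprincipal_def)
  have inj: "inj_on (\<lambda>x. g \<otimes> x) (carrier G)" using g(1) by (intro inj_onI) simp
  moreover have "(\<lambda>x. g \<otimes> x) ` carrier G = carrier G"
    by (rule endo_inj_surj[OF finite_carrier _ inj]) (use g(1) in auto)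
  ultimately have "bij_betw (\<lambda>x. g \<otimes> x) (carrier G) (carrier G)" by (simp add: bij_betw_def)
  then have "(\<Sum>x\<in>carrier G. \<chi> x) = (\<Sum>x\<in>carrier G. \<chi> (g \<otimes> x))"
    by (rule sum.reindex_bij_betw[symmetric])
  also have "\<dots> = \<chi> g * (\<Sum>x\<in>carrier G. \<chi> x)"
    unfolding sum_distrib_left using g(1) by (intro sum.cong) (simp_all add: chi_mult)
  finally show ?thesis using g(2) by simp
qed

lemma char_sum_in_int_adjoin:
  assumes "S \<subseteq> carrier G"
  shows "char_sum \<chi> S \<in> int_adjoin (cis (2 * pi / real (character_order G \<chi>)))"
  unfolding char_sum_def using assms
  by (intro int_adjoin_sum root_of_unity_in_int_adjoin_cis chi_power_character_order
      character_order_pos) auto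

text \<open>Both sides are the sum of \<open>\<chi>\<close> over the multiset of differences for
  block \<open>j\<close>. Over the triples this sum factors; over the group it is \<open>lam\<close>
  times the sum of \<open>\<chi>\<close> over the nonidentity elements, which is -1.\<close>

lemma sedf_char_sum_equation:
  assumes sedf: "is_SEDF G v m k lam D" and np: "nonprincipal G \<chi>" and j: "j \<in> {1..m}"
  shows "((\<Sum>i=1..m. char_sum \<chi> (D i)) - char_sum \<chi> (D j)) * cnj (char_sum \<chi> (D j)) = - of_nat lam"
proof -
  have sub: "D i \<subseteq> carrier G" if "i \<in> {1..m}" for i
    using sedf that by (auto simp: is_SEDF_def)
  have fin: "finite (D i)" if "i \<in> {1..m}" for i
    using sub[OF that] finite_carrier finite_subset by blast
  define S where "S = (SIGMA l:{1..m} - {j}. D l \<times> D j)"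
  define f where "f = (\<lambda>(l::nat, x, y). x \<otimes> inv y)"
  have finS: "finite S"
    unfolding S_def using fin j by (intro finite_SigmaI finite_cartesian_product) auto
  have fS: "f s \<in> carrier G" if "s \<in> S" for s
  proof -
    obtain l x y where "s = (l, x, y)" "l \<in> {1..m}" "x \<in> D l" "y \<in> D j"
      using \<open>s \<in> S\<close> by (auto simp: S_def)
    then show ?thesis using sub[of l] sub[OF j] by (auto simp: f_def subset_iff)
  qed
  have cnt: "count (sedf_differences G m D j) g = card {s \<in> S. f s = g}" for g
  proof -
    have "count (sedf_differences G m D j) g = (\<Sum>s\<in>f -` {g} \<inter> S. count (mset_set S) s)"
      unfolding sedf_differences_def S_def[symmetric] f_def[symmetric] count_image_mset
      using finS by simp
    also have "\<dots> = (\<Sum>s\<in>f -` {g} \<inter> S. 1)"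
      using finS by (intro sum.cong) auto
    also have "\<dots> = card {s \<in> S. f s = g}"
      by (simp add: vimage_def Int_def conj_commute)
    finally show ?thesis .
  qed
  have count_g: "count (sedf_differences G m D j) g = (if g = \<one> then 0 else lam)"
    if "g \<in> carrier G" for g
    using sedf j that by (auto simp: is_SEDF_def not_in_iff)
  have "(\<Sum>s\<in>S. \<chi> (f s)) = (\<Sum>g\<in>carrier G. \<Sum>s\<in>{s \<in> S. f s = g}. \<chi> (f s))"
    using finS finite_carrier fS by (intro sum.group[symmetric]) auto
  also have "\<dots> = (\<Sum>g\<in>carrier G. of_nat (if g = \<one> then 0 else lam) * \<chi> g)"
    by (intro sum.cong refl) (simp add: cnt[symmetric] count_g)
  also have "\<dots> = (\<Sum>g\<in>carrier G. of_nat lam * \<chi> g - (if g = \<one> then of_nat lam else 0))"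
    by (intro sum.cong refl) (auto simp: chi_one)
  also have "\<dots> = - of_nat lam"
    using finite_carrier by (simp add: sum_subtractf sum_distrib_left[symmetric] sum_chi_carrier[OF np])
  finally have rhs: "(\<Sum>s\<in>S. \<chi> (f s)) = - of_nat lam" .
  have "(\<Sum>s\<in>S. \<chi> (f s)) = (\<Sum>l\<in>{1..m} - {j}. \<Sum>s\<in>D l \<times> D j. \<chi> (f (l, s)))"
    unfolding S_def using fin j by (subst sum.Sigma) auto
  also have "\<dots> = (\<Sum>l\<in>{1..m} - {j}. \<Sum>x\<in>D l. \<Sum>y\<in>D j. \<chi> x * cnj (\<chi> y))"
  proof (rule sum.cong[OF refl])
    fix l assume l: "l \<in> {1..m} - {j}"
    have "(\<Sum>s\<in>D l \<times> D j. \<chi> (f (l, s))) = (\<Sum>x\<in>D l. \<Sum>y\<in>D j. \<chi> (x \<otimes> inv y))"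
      by (simp add: sum.cartesian_product f_def case_prod_unfold)
    also have "\<dots> = (\<Sum>x\<in>D l. \<Sum>y\<in>D j. \<chi> x * cnj (\<chi> y))"
      using l j sub by (intro sum.cong refl) (auto simp: chi_mult chi_inv subset_iff)
    finally show "(\<Sum>s\<in>D l \<times> D j. \<chi> (f (l, s))) = (\<Sum>x\<in>D l. \<Sum>y\<in>D j. \<chi> x * cnj (\<chi> y))" .
  qed
  also have "\<dots> = (\<Sum>l\<in>{1..m} - {j}. char_sum \<chi> (D l)) * cnj (char_sum \<chi> (D j))"
    unfolding char_sum_def cnj_sum sum_distrib_right unfolding sum_distrib_left ..
  also have "(\<Sum>l\<in>{1..m} - {j}. char_sum \<chi> (D l)) = (\<Sum>i=1..m. char_sum \<chi> (D i)) - char_sum \<chi> (D j)"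
    using j by (simp add: sum_diff1)
  finally show ?thesis using rhs by simp
qed

end

text \<open>The ratio \<open>x / y\<close> is real, since its conjugate is a squared modulus minus a
  real number. It is then a root of r^2 - r = lam / |y|^2, and \<open>s\<close> is the sign of the
  square root.\<close>

lemma sedf_ratio:
  fixes x y :: complex
  assumes "(y - x) * cnj x = - of_nat lam" "y \<noteq> 0"
  obtains s :: int where "s\<^sup>2 = 1"
    "x = y * of_real ((1 + of_int s * sqrt (1 + 4 * real lam / (cmod y)\<^sup>2)) / 2)"
proof -
  define w where "w = x / y"
  define t where "t = real lam / (cmod y)\<^sup>2"
  have x: "x = y * w" using assms(2) by (simp add: w_def)
  have "(1 - w) * cnj w * of_real ((cmod y)\<^sup>2) = (y - x) * cnj x"
    unfolding x complex_norm_square by (simp add: algebra_simps)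
  then have "(1 - w) * cnj w * of_real ((cmod y)\<^sup>2) = - of_nat lam" using assms(1) by simp
  moreover have "of_real ((cmod y)\<^sup>2) \<noteq> (0::complex)" using assms(2) by simp
  ultimately have "(1 - w) * cnj w = - of_nat lam / of_real ((cmod y)\<^sup>2)"
    by (metis nonzero_mult_div_cancel_right)
  then have w: "(1 - w) * cnj w = - of_real t"
    by (simp add: t_def)
  then have cw: "cnj w = of_real ((cmod w)\<^sup>2 - t)"
    unfolding of_real_diff complex_norm_square by (simp add: algebra_simps)
  then have "w = of_real ((cmod w)\<^sup>2 - t)" by (metis complex_cnj_cnj complex_cnj_complex_of_real)
  then obtain r where r: "w = of_real r" by blast
  have "of_real ((1 - r) * r) = (of_real (- t) :: complex)"
    using w unfolding r by simp
  then have "(1 - r) * r = - t" by (simp only: of_real_eq_iff)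
  then have "(2 * r - 1)\<^sup>2 = 1 + 4 * t" by (simp add: power2_eq_square algebra_simps)
  then have "\<bar>2 * r - 1\<bar> = sqrt (1 + 4 * t)" by (metis real_sqrt_abs)
  then have "2 * r - 1 = 1 * sqrt (1 + 4 * t) \<or> 2 * r - 1 = (- 1) * sqrt (1 + 4 * t)" by linarith
  then obtain s :: int where s: "s\<^sup>2 = 1" "2 * r - 1 = of_int s * sqrt (1 + 4 * t)"
  proof
    assume "2 * r - 1 = 1 * sqrt (1 + 4 * t)"
    then show thesis using that[of 1] by simp
  next
    assume "2 * r - 1 = (- 1) * sqrt (1 + 4 * t)"
    then show thesis using that[of "- 1"] by simp
  qed
  then have "r = (1 + of_int s * sqrt (1 + 4 * real lam / (cmod y)\<^sup>2)) / 2"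
    by (simp add: t_def)
  then show ?thesis using that[OF s(1)] x r by blast
qed

text \<open>The ratios of the \<open>x j\<close> to their sum are \<open>(1 \<plusminus> \<alpha>) / 2\<close> and add up to \<open>1\<close>, so that an
  integer multiple of \<open>\<alpha>\<close> equals \<open>2 - m \<noteq> 0\<close>.\<close>

lemma sedf_alpha_rational:
  fixes x :: "nat \<Rightarrow> complex"
  assumes y: "y = (\<Sum>i=1..m. x i)" "y \<noteq> 0" and m: "m \<ge> 3"
    and eq: "\<And>j. j \<in> {1..m} \<Longrightarrow> (y - x j) * cnj (x j) = - of_nat lam"
  shows "sqrt (1 + 4 * real lam / (cmod y)\<^sup>2) \<in> \<rat>"
proof -
  define \<alpha> where "\<alpha> = sqrt (1 + 4 * real lam / (cmod y)\<^sup>2)"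
  have "\<exists>s::int. x j = y * of_real ((1 + of_int s * \<alpha>) / 2)" if "j \<in> {1..m}" for j
    unfolding \<alpha>_def using sedf_ratio[OF eq[OF that] y(2)] by metis
  then obtain s :: "nat \<Rightarrow> int" where s: "\<And>j. j \<in> {1..m} \<Longrightarrow> x j = y * of_real ((1 + of_int (s j) * \<alpha>) / 2)"
    by metis
  have "y = (\<Sum>j=1..m. y * of_real ((1 + of_int (s j) * \<alpha>) / 2))"
    using y(1) s by simp
  then have "y * 1 = y * of_real (\<Sum>j=1..m. (1 + of_int (s j) * \<alpha>) / 2)"
    by (simp add: sum_distrib_left)
  then have "of_real (\<Sum>j=1..m. (1 + of_int (s j) * \<alpha>) / 2) = (of_real 1 :: complex)"
    using y(2) by (metis mult_left_cancel of_real_1)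
  then have "(\<Sum>j=1..m. (1 + of_int (s j) * \<alpha>) / 2) = 1"
    by (simp only: of_real_eq_iff)
  then have "real m + of_int (\<Sum>j=1..m. s j) * \<alpha> = 2"
    by (simp add: sum_divide_distrib[symmetric] sum.distrib sum_distrib_right)
  then have e: "of_int (\<Sum>j=1..m. s j) * \<alpha> = 2 - real m" by simp
  moreover have "(\<Sum>j=1..m. s j) \<noteq> 0"
  proof
    assume "(\<Sum>j=1..m. s j) = 0"
    from e[unfolded this] m show False by simp
  qed
  ultimately have "\<alpha> = (2 - real m) / of_int (\<Sum>j=1..m. s j)"
    by (metis nonzero_mult_div_cancel_left of_int_eq_0_iff)
  then show ?thesis unfolding \<alpha>_def[symmetric]
    by (rule ssubst) (intro Rats_divide Rats_diff Rats_of_int Rats_of_nat Rats_number_of)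
qed

theorem theorem4p16:
  fixes G :: "('a, 'b) monoid_scheme"
    and D :: "nat \<Rightarrow> 'a set"
    and \<chi> :: "'a \<Rightarrow> complex"
    and v m k lam p a q b :: nat
  defines "U \<equiv> \<Union>i\<in>{1..m}. D i"
  defines "a\<chi> \<equiv> sedf_a \<chi> lam U" and "b\<chi> \<equiv> sedf_b \<chi> lam U"
  assumes "comm_group G" and "finite (carrier G)" and "order G = v"
    and "is_SEDF G v m k lam D" and "m \<ge> 3"
    and "prime p" and "p > 2" and "p dvd v" and "\<not> p dvd lam"
    and "is_character G \<chi>" and "nonprincipal G \<chi>" and "character_order G \<chi> = p ^ a"
    and "prime q" and "q dvd lam" and "q ^ b dvd lam" and "self_conjugate_mod q (p ^ a)"
    and "nonsquare_integer (real lam)"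
    and "(\<Sum>i=1..m. char_sum \<chi> (D i)) \<noteq> 0 \<Longrightarrow>
      nonsquare_integer (4 * real lam / ((real b\<chi>)\<^sup>2 - (real a\<chi>)\<^sup>2))"
  shows "((\<Sum>i=1..m. char_sum \<chi> (D i)) = 0 \<longrightarrow>
      real p \<le> (real lam / real q ^ (2 * ((b + 1) div 2)))\<^sup>2
               + real lam / real q ^ (2 * ((b + 1) div 2)) + 1) \<and>
    (gcd (a\<chi> + b\<chi>) (2 * a\<chi>) = 1 \<and> (\<Sum>i=1..m. char_sum \<chi> (D i)) \<noteq> 0 \<longrightarrow>
      real p \<le> (real lam / ((real b\<chi>)\<^sup>2 - (real a\<chi>)\<^sup>2))\<^sup>2
               + real lam / ((real b\<chi>)\<^sup>2 - (real a\<chi>)\<^sup>2) + 1) \<and>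
    (gcd (a\<chi> + b\<chi>) (2 * a\<chi>) = 2 \<and> (\<Sum>i=1..m. char_sum \<chi> (D i)) \<noteq> 0 \<longrightarrow>
      real p \<le> (4 * real lam / ((real b\<chi>)\<^sup>2 - (real a\<chi>)\<^sup>2))\<^sup>2
               + 4 * real lam / ((real b\<chi>)\<^sup>2 - (real a\<chi>)\<^sup>2) + 1)"
proof -
  define X where "X = (\<lambda>i. char_sum \<chi> (D i))"
  define A where "A = (\<Sum>i=1..m. X i)"
  have np: "nonprincipal G \<chi>" and co: "character_order G \<chi> = p ^ a" by fact+
  interpret comm_group G by fact
  interpret finite_group_character G \<chi>
    by unfold_locales fact+
  have sedf: "is_SEDF G v m k lam D" by fact
  have sub: "D i \<subseteq> carrier G" if "i \<in> {1..m}" for i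
    using sedf that by (auto simp: is_SEDF_def)
  have "a \<noteq> 0"
  proof
    assume "a = 0"
    then have "\<chi> x = 1" if "x \<in> carrier G" for x
      using chi_power_character_order[OF that] by (simp add: co)
    then show False using np by (auto simp: nonprincipal_def)
  qed
  then obtain l where l: "a = Suc l" using not0_implies_Suc by blast
  define z where "z = cis (2 * pi / real (p * p ^ l))"
  interpret prime_power_root_of_unity p l "p * p ^ l" "p ^ l" z
    unfolding z_def by (rule prime_power_root_of_unity_cis) fact
  have X: "X i \<in> int_adjoin z" if "i \<in> {1..m}" for i
    using char_sum_in_int_adjoin[OF sub[OF that]] by (simp add: X_def z_def co l)
  then have A: "A \<in> int_adjoin z" unfolding A_def by (rule int_adjoin_sum)
  have eq: "(A - X j) * cnj (X j) = - of_nat lam" if "j \<in> {1..m}" for j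
    using sedf_char_sum_equation[OF sedf np that] by (simp add: A_def X_def)
  \<comment> \<open>The bounds are read off the value on the first block alone.\<close>
  have one: "1 \<in> {1..m}" using \<open>m \<ge> 3\<close> by simp
  have lam_nonsquare: "real lam \<noteq> (of_int s)\<^sup>2" for s :: int
    using \<open>nonsquare_integer (real lam)\<close> by (auto simp: nonsquare_integer_def)
  have lam_pos: "lam > 0" using lam_nonsquare[of 0] by auto
  have zero_case: "real p \<le> (real lam / real q ^ (2 * ((b + 1) div 2)))\<^sup>2
      + real lam / real q ^ (2 * ((b + 1) div 2)) + 1" if "A = 0"
  proof -
    obtain s u r where su: "p ^ a = q ^ s * u" "[int q ^ r = - 1] (mod int u)"
      using \<open>self_conjugate_mod q (p ^ a)\<close> by (auto simp: self_conjugate_mod_def)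
    \<comment> \<open>\<open>q\<close> divides \<open>lam\<close> and \<open>p\<close> does not, so
      \<open>q\<close> differs from \<open>p\<close> and all of \<open>p ^ a\<close> is prime to
      \<open>q\<close>.\<close>
    have "s = 0"
    proof (rule ccontr)
      assume "s \<noteq> 0"
      then have "q dvd p ^ a" unfolding su(1) by (intro dvd_mult2) simp
      then have "q dvd p" using \<open>prime q\<close> prime_dvd_power by blast
      then have "q = p" using \<open>prime q\<close> \<open>prime p\<close> primes_dvd_imp_eq by blast
      then show False using \<open>q dvd lam\<close> \<open>\<not> p dvd lam\<close> by simp
    qed
    then have "[int q ^ r = - 1] (mod int (p * p ^ l))" using su by (simp add: l)
    moreover have "p * p ^ l > 2"
      using \<open>p > 2\<close> M_pos by (metis less_le_trans mult_le_mono2 mult.right_neutral Suc_leI One_nat_def)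
    moreover have "X 1 * cnj (X 1) = of_nat lam" using eq[OF one] that by simp
    ultimately show ?thesis
      using prime_le_of_self_conjugate \<open>prime q\<close> X[OF one] \<open>q ^ b dvd lam\<close> lam_nonsquare by blast
  qed
  have nonzero_case: "(gcd (a\<chi> + b\<chi>) (2 * a\<chi>) = 1 \<longrightarrow>
      real p \<le> (real lam / ((real b\<chi>)\<^sup>2 - (real a\<chi>)\<^sup>2))\<^sup>2
               + real lam / ((real b\<chi>)\<^sup>2 - (real a\<chi>)\<^sup>2) + 1) \<and>
    (gcd (a\<chi> + b\<chi>) (2 * a\<chi>) = 2 \<longrightarrow>
      real p \<le> (4 * real lam / ((real b\<chi>)\<^sup>2 - (real a\<chi>)\<^sup>2))\<^sup>2
               + 4 * real lam / ((real b\<chi>)\<^sup>2 - (real a\<chi>)\<^sup>2) + 1)" if A0: "A \<noteq> 0"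
  proof -
    have "char_sum \<chi> U = A"
    proof -
      have "finite (D i)" if "i \<in> {1..m}" for i
        using sub[OF that] finite_carrier finite_subset by blast
      moreover have "disjoint_family_on D {1..m}" using sedf by (simp add: is_SEDF_def)
      ultimately show ?thesis
        unfolding U_def A_def X_def char_sum_def disjoint_family_on_def
        by (intro sum.UNION_disjoint) auto
    qed
    then have \<alpha>: "sedf_alpha \<chi> lam U = sqrt (1 + 4 * real lam / (cmod A)\<^sup>2)"
      by (simp add: sedf_alpha_def)
    define \<alpha> where "\<alpha> = sqrt (1 + 4 * real lam / (cmod A)\<^sup>2)"
    have quot_pos: "4 * real lam / (cmod A)\<^sup>2 > 0" using lam_pos A0 by simp
    then have \<alpha>1: "\<alpha> > 1" by (simp add: \<alpha>_def)
    have "\<alpha> \<in> \<rat>" unfolding \<alpha>_def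
      by (rule sedf_alpha_rational[of A X m]) (use A0 \<open>m \<ge> 3\<close> eq A_def in auto)
    then obtain b0 a0 :: nat where ba: "a0 \<noteq> 0" "\<bar>\<alpha>\<bar> = real b0 / real a0" "coprime b0 a0"
      using Rats_abs_nat_div_natE by metis
    then have \<alpha>ba: "\<alpha> = real b0 / real a0" using \<alpha>1 by simp
    then have b0: "b0 > 0" using \<alpha>1 by (intro gr0I) auto
    have ab: "a\<chi> = a0" "b\<chi> = b0"
      unfolding a\<chi>_def b\<chi>_def
      using sedf_a_b_eqI[of a0 b0 \<chi> lam U] ba(1,3) b0 \<alpha>ba
      by (simp_all add: \<alpha> \<alpha>_def coprime_iff_gcd_eq_1 gcd.commute)
    have "a0 < b0" using \<alpha>1 ba(1) by (simp add: \<alpha>ba)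
    define \<Delta> where "\<Delta> = (real b0)\<^sup>2 - (real a0)\<^sup>2"
    have \<Delta>: "\<Delta> > 0" using \<open>a0 < b0\<close> by (simp add: \<Delta>_def power_strict_mono)
    have \<Delta>_rat: "\<Delta> \<in> \<rat>" by (simp add: \<Delta>_def)
    have "(real b0)\<^sup>2 / (real a0)\<^sup>2 = 1 + 4 * real lam / (cmod A)\<^sup>2"
      using \<alpha>ba quot_pos by (metis \<alpha>_def power_divide real_sqrt_pow2 less_eq_real_def add_nonneg_nonneg zero_le_one)
    then have "(real b0)\<^sup>2 * (cmod A)\<^sup>2 = (real a0)\<^sup>2 * (cmod A)\<^sup>2 + 4 * real lam * (real a0)\<^sup>2"
      using ba(1) A0 by (simp add: field_simps)
    then have "(cmod A)\<^sup>2 * \<Delta> = 4 * real lam * (real a0)\<^sup>2"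
      by (simp add: \<Delta>_def algebra_simps)
    then have normA: "(cmod A)\<^sup>2 = 4 * real lam / \<Delta> * (real a0)\<^sup>2"
      using \<Delta> by (simp add: field_simps)
    have nonsquare4: "4 * real lam / \<Delta> \<noteq> (of_int s)\<^sup>2" for s :: int
    proof -
      have "nonsquare_integer (4 * real lam / ((real b\<chi>)\<^sup>2 - (real a\<chi>)\<^sup>2))"
        using assms(21) A0 by (simp add: A_def X_def)
      then show ?thesis by (auto simp: nonsquare_integer_def ab \<Delta>_def)
    qed
    obtain s :: int where s: "s\<^sup>2 = 1" "X 1 = A * of_real ((1 + of_int s * \<alpha>) / 2)"
      using sedf_ratio[OF eq[OF one] A0] unfolding \<alpha>_def by blast
    have X1: "X 1 = A * of_int (int a0 + s * int b0) / of_int (2 * int a0)"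
      unfolding s(2) \<alpha>ba using ba(1) by (simp add: field_simps)
    have s_cases: "s = 1 \<or> s = - 1" using s(1) by (simp add: power2_eq_1_iff)
    \<comment> \<open>Subtracting \<open>a0 - b0\<close> from \<open>2 * a0\<close> gives
      \<open>a0 + b0\<close>; so the gcd does not depend on which of the two values
      \<open>X 1\<close> takes.\<close>
    have gcd_s: "gcd (int a0 + s * int b0) (2 * int a0) = int (gcd (a0 + b0) (2 * a0))"
    proof -
      have "2 * int a0 - (int a0 - int b0) = int a0 + int b0" by simp
      then have "gcd (int a0 - int b0) (2 * int a0) = gcd (int a0 + int b0) (2 * int a0)"
        using gcd_diff2[of "2 * int a0" "int a0 - int b0"] by simp
      moreover have "gcd (int a0 + int b0) (2 * int a0) = int (gcd (a0 + b0) (2 * a0))"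
        using gcd_int_int_eq[of "a0 + b0" "2 * a0"] by simp
      ultimately show ?thesis using s_cases by (elim disjE) simp_all
    qed
    show ?thesis
      unfolding ab \<Delta>_def[symmetric]
    proof (intro conjI impI)
      assume "gcd (a0 + b0) (2 * a0) = 1"
      then have cop: "coprime (int a0 + s * int b0) (2 * int a0)"
        using gcd_s by (simp add: coprime_iff_gcd_eq_1)
      have ns: "real lam / \<Delta> \<noteq> (of_int t)\<^sup>2" for t :: int
        using nonsquare4[of "2 * t"] by auto
      \<comment> \<open>The denominator is the full \<open>2 * a0\<close>, whose square absorbs the
        factor 4.\<close>
      have norm: "(cmod A)\<^sup>2 = real lam / \<Delta> * (of_int (2 * int a0))\<^sup>2"
        unfolding normA by (simp add: power2_eq_square)
      show "real p \<le> (real lam / \<Delta>)\<^sup>2 + real lam / \<Delta> + 1"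
        by (rule prime_le_of_coprime_ratio[OF A X[OF one, unfolded X1] cop _ norm _ ns])
          (use ba(1) \<Delta>_rat in auto)
    next
      assume g2: "gcd (a0 + b0) (2 * a0) = 2"
      \<comment> \<open>Numerator and denominator are halved, which leaves the reduced denominator
        \<open>a0\<close> and keeps the factor 4 in the bound.\<close>
      define e where "e = (int a0 + s * int b0) div 2"
      have g: "gcd (int a0 + s * int b0) (2 * int a0) = 2" using gcd_s g2 by simp
      then have "2 dvd int a0 + s * int b0" by (metis gcd_dvd1)
      then have e: "int a0 + s * int b0 = 2 * e" by (simp add: e_def)
      then have "2 * gcd e (int a0) = 2 * 1"
        using g gcd_mult_distrib_int[of 2 e "int a0"] by simp
      then have cop: "coprime e (int a0)" by (simp add: coprime_iff_gcd_eq_1)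
      have "X 1 = A * of_int e / of_int (int a0)"
        unfolding X1 e by simp
      then have ratio: "A * of_int e / of_int (int a0) \<in> int_adjoin z" using X[OF one] by simp
      have norm: "(cmod A)\<^sup>2 = 4 * real lam / \<Delta> * (of_int (int a0))\<^sup>2" using normA by simp
      show "real p \<le> (4 * real lam / \<Delta>)\<^sup>2 + 4 * real lam / \<Delta> + 1"
        by (rule prime_le_of_coprime_ratio[OF A ratio cop _ norm _ nonsquare4])
          (use ba(1) \<Delta>_rat in auto)
    qed
  qed
  have "(\<Sum>i=1..m. char_sum \<chi> (D i)) = A" by (simp only: A_def X_def)
  then show ?thesis
    using zero_case nonzero_case by (cases "A = 0") simp_all
qed

end
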